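(* Suppose that $\lambda$ is a regular uncountable cardinal satisfying $2^\lambda=\lambda^+$. If $\mathbb P$ is a $\lambda^+$-cc notion of forcing of size $\le 2^\lambda$, then each of the following implies that $\mathbb P\in\mathbb C_\lambda$: \begin{itemize} \item $\mathbb P$ preserves the regularity of $\lambda$, and is not ${}^\lambda\lambda$-bounding, that is, in $V^{\mathbb P}$ there exists $g\in{}^\lambda\lambda$ such that for every $f\in{}^\lambda\lambda\cap V$ there is some $\alpha<\lambda$ with $f(\alpha)<g(\alpha)$; \item $\mathbb P$ forces that $\lambda$ is a singular cardinal; \item $\mathbb P$ forces that $\lambda$ is a singular ordinal satisfying $2^{\operatorname{cf}(\lambda)}<\lambda$. \end{itemize}
   Context: $V$ is the ground model, and statements about $V^{\mathbb P}$ are statements about the generic extensions of $V$ by $\mathbb P$. For a regular uncountable cardinal $\lambda$, $\mathbb C_\lambda$ denotes the class of all notions of forcing $\mathbb P$ satisfying the two items: (1) $\mathbb P$ is $\lambda^+$-cc and has size $\le 2^\lambda$; (2) in $V^{\mathbb P}$, there exists a cofinal subset $\Lambda\subseteq\lambda$ such that for every function $f\in{}^\lambda\lambda\cap V$, there exists some $\xi\in\Lambda$ with $f(\xi)<\min(\Lambda\setminus(\xi+1))$. A notion of forcing $\mathbb P$ is ${}^\lambda\lambda$-bounding if for every $g\in{}^\lambda\lambda\cap V^{\mathbb P}$ there exists some $f\in{}^\lambda\lambda\cap V$ such that $g(\alpha)\le f(\alpha)$ for all $\alpha<\lambda$. *)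

theory Defs
  imports Main
begin

unbundle cardinal_syntax

section \<open>Notions of forcing\<close>

text \<open>
  A notion of forcing is a nonempty preorder, represented by its order relation \<open>Q\<close>, whose
  conditions are the elements of \<open>Field Q\<close>; \<open>(q, p) \<in> Q\<close> means that \<open>q\<close> is stronger than
  (or equal to) \<open>p\<close>.  The ambient universe of HOL plays the role of the ground model \<open>V\<close>.
\<close>

definition notion_of_forcing :: "'p rel \<Rightarrow> bool" where
  "notion_of_forcing Q \<longleftrightarrow> Preorder Q \<and> Field Q \<noteq> {}"

definition compatible :: "'p rel \<Rightarrow> 'p \<Rightarrow> 'p \<Rightarrow> bool" where
  "compatible Q p q \<longleftrightarrow> (\<exists>s. (s, p) \<in> Q \<and> (s, q) \<in> Q)"

definition antichain :: "'p rel \<Rightarrow> 'p set \<Rightarrow> bool" where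
  "antichain Q A \<longleftrightarrow> A \<subseteq> Field Q \<and> (\<forall>p\<in>A. \<forall>q\<in>A. p \<noteq> q \<longrightarrow> \<not> compatible Q p q)"

definition chain_condition :: "'k rel \<Rightarrow> 'p rel \<Rightarrow> bool" where
  "chain_condition \<kappa> Q \<longleftrightarrow> (\<forall>A. antichain Q A \<longrightarrow> |A| <o \<kappa>)"


section \<open>The forcing relation\<close>

text \<open>
  A sentence of the forcing language is identified with its forcing relation:
  \<open>\<phi> Q p\<close> says that the condition \<open>p\<close> of \<open>Q\<close> forces \<open>\<phi>\<close>.  The clauses are the usual
  recursive ones for atoms, negation, conjunction and universal quantification; the other
  connectives are the classical abbreviations.
\<close>

type_synonym 'p sentence = "'p rel \<Rightarrow> 'p \<Rightarrow> bool"

definition forced :: "'p rel \<Rightarrow> 'p sentence \<Rightarrow> bool" where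
  "forced Q \<phi> \<longleftrightarrow> (\<forall>p\<in>Field Q. \<phi> Q p)"

text \<open>
  \<open>Ground b\<close> is the atomic (absolute) statement \<open>b\<close> about elements of the ground model, for
  instance \<open>\<alpha> < \<beta>\<close> or \<open>\<alpha> = \<beta>\<close> for two ordinals.
\<close>

definition Ground :: "bool \<Rightarrow> 'p sentence" where
  "Ground b = (\<lambda>Q p. b)"

definition fNot :: "'p sentence \<Rightarrow> 'p sentence" (\<open>\<^bold>\<not> _\<close> [40] 40) where
  "(\<^bold>\<not> \<phi>) = (\<lambda>Q p. \<not> (\<exists>q. (q, p) \<in> Q \<and> \<phi> Q q))"

definition fAnd :: "'p sentence \<Rightarrow> 'p sentence \<Rightarrow> 'p sentence" (infixr \<open>\<^bold>\<and>\<close> 35) where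
  "(\<phi> \<^bold>\<and> \<psi>) = (\<lambda>Q p. \<phi> Q p \<and> \<psi> Q p)"

definition fImp :: "'p sentence \<Rightarrow> 'p sentence \<Rightarrow> 'p sentence" (infixr \<open>\<^bold>\<longrightarrow>\<close> 25) where
  "(\<phi> \<^bold>\<longrightarrow> \<psi>) = (\<^bold>\<not> (\<phi> \<^bold>\<and> \<^bold>\<not> \<psi>))"

definition fIff :: "'p sentence \<Rightarrow> 'p sentence \<Rightarrow> 'p sentence" (infixr \<open>\<^bold>\<longleftrightarrow>\<close> 25) where
  "(\<phi> \<^bold>\<longleftrightarrow> \<psi>) = ((\<phi> \<^bold>\<longrightarrow> \<psi>) \<^bold>\<and> (\<psi> \<^bold>\<longrightarrow> \<phi>))"

text \<open>
  Quantification over the elements of a set \<open>A\<close> of the ground model (that is, over the members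
  of its canonical name).  With \<open>A\<close> a set of ground model functions this is quantification over
  functions that belong to \<open>V\<close>.
\<close>

definition fAll :: "'a set \<Rightarrow> ('a \<Rightarrow> 'p sentence) \<Rightarrow> 'p sentence" where
  "fAll A \<phi> = (\<lambda>Q p. \<forall>a\<in>A. \<phi> a Q p)"

definition fEx :: "'a set \<Rightarrow> ('a \<Rightarrow> 'p sentence) \<Rightarrow> 'p sentence" where
  "fEx A \<phi> = (\<^bold>\<not> fAll A (\<lambda>a. \<^bold>\<not> \<phi> a))"

text \<open>
  Quantification over all subsets, lying in the generic extension, of a set \<open>A\<close> of the ground
  model.  A name for such a subset is a set of pairs \<open>(a, p)\<close> with \<open>a \<in> A\<close> and \<open>p\<close> a
  condition, the element \<open>a\<close> standing for its canonical name; every subset of \<open>A\<close> in a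
  generic extension has a name of this form.
\<close>

type_synonym ('a, 'p) sname = "('a \<times> 'p) set"

definition names :: "'p rel \<Rightarrow> 'a set \<Rightarrow> ('a, 'p) sname set" where
  "names Q A = Pow (A \<times> Field Q)"

definition fMem :: "'a \<Rightarrow> ('a, 'p) sname \<Rightarrow> 'p sentence" (infix \<open>\<^bold>\<in>\<close> 50) where
  "(a \<^bold>\<in> \<tau>) = (\<lambda>Q p. \<forall>q. (q, p) \<in> Q \<longrightarrow> (\<exists>s t. (s, q) \<in> Q \<and> (a, t) \<in> \<tau> \<and> (s, t) \<in> Q))"

definition fAll_sub :: "'a set \<Rightarrow> (('a, 'p) sname \<Rightarrow> 'p sentence) \<Rightarrow> 'p sentence" where
  "fAll_sub A \<phi> = (\<lambda>Q p. \<forall>\<tau>\<in>names Q A. \<phi> \<tau> Q p)"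

definition fEx_sub :: "'a set \<Rightarrow> (('a, 'p) sname \<Rightarrow> 'p sentence) \<Rightarrow> 'p sentence" where
  "fEx_sub A \<phi> = (\<^bold>\<not> fAll_sub A (\<lambda>\<tau>. \<^bold>\<not> \<phi> \<tau>))"

lemma fEx_iff:
  "fEx A \<phi> Q p \<longleftrightarrow> (\<forall>q. (q, p) \<in> Q \<longrightarrow> (\<exists>s. (s, q) \<in> Q \<and> (\<exists>a\<in>A. \<phi> a Q s)))"
  unfolding fEx_def fAll_def fNot_def by blast

lemma fEx_sub_iff:
  "fEx_sub A \<phi> Q p \<longleftrightarrow> (\<forall>q. (q, p) \<in> Q \<longrightarrow> (\<exists>s. (s, q) \<in> Q \<and> (\<exists>\<tau>\<in>names Q A. \<phi> \<tau> Q s)))"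
  unfolding fEx_sub_def fAll_sub_def fNot_def by blast

text \<open>
  Functions from \<open>A\<close> to \<open>B\<close> in the generic extension, where \<open>A\<close> and \<open>B\<close> are sets of the
  ground model: a function is a total single-valued subset of \<open>A \<times> B\<close>.
\<close>

definition is_fun :: "'a set \<Rightarrow> 'b set \<Rightarrow> ('a \<times> 'b, 'p) sname \<Rightarrow> 'p sentence" where
  "is_fun A B h =
     fAll A (\<lambda>a. fEx B (\<lambda>b. ((a, b) \<^bold>\<in> h) \<^bold>\<and> fAll B (\<lambda>b'. ((a, b') \<^bold>\<in> h) \<^bold>\<longrightarrow> Ground (b' = b))))"

definition fEx_fun :: "'a set \<Rightarrow> 'b set \<Rightarrow> (('a \<times> 'b, 'p) sname \<Rightarrow> 'p sentence) \<Rightarrow> 'p sentence" where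
  "fEx_fun A B \<phi> = fEx_sub (A \<times> B) (\<lambda>h. is_fun A B h \<^bold>\<and> \<phi> h)"


section \<open>Statements about \<open>\<lambda>\<close> in the generic extension\<close>

text \<open>
  A cardinal \<open>\<lambda>\<close> of the ground model is given by a cardinal order \<open>r\<close>.  The elements of
  \<open>Field r\<close> are the ordinals below \<open>\<lambda>\<close>, \<open>(\<alpha>, \<beta>) \<in> r\<close> means \<open>\<alpha> \<le> \<beta>\<close>, and
  \<open>underS r \<alpha>\<close> is the set of ordinals below \<open>\<alpha>\<close>.  The generic extension has the same ordinals.
\<close>

definition lt :: "'a rel \<Rightarrow> 'a \<Rightarrow> 'a \<Rightarrow> bool" where
  "lt r \<alpha> \<beta> \<longleftrightarrow> \<alpha> \<in> underS r \<beta>"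

definition Cofinal_map :: "'a rel \<Rightarrow> 'a \<Rightarrow> 'p sentence" where
  "Cofinal_map r \<alpha> =
     fEx_fun (underS r \<alpha>) (Field r) (\<lambda>h.
       fAll (Field r) (\<lambda>\<gamma>. fEx (underS r \<alpha>) (\<lambda>\<xi>. fEx (Field r) (\<lambda>\<eta>.
         ((\<xi>, \<eta>) \<^bold>\<in> h) \<^bold>\<and> Ground ((\<gamma>, \<eta>) \<in> r)))))"

text \<open>\<open>cf(\<lambda>) = \<kappa>\<close>, for \<open>\<kappa> < \<lambda>\<close>.\<close>

definition Cf_eq :: "'a rel \<Rightarrow> 'a \<Rightarrow> 'p sentence" where
  "Cf_eq r \<kappa> = (Cofinal_map r \<kappa> \<^bold>\<and> fAll (underS r \<kappa>) (\<lambda>\<alpha>. \<^bold>\<not> Cofinal_map r \<alpha>))"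

text \<open>\<open>cf(\<lambda>) = \<lambda>\<close>\<close>

definition Regular :: "'a rel \<Rightarrow> 'p sentence" where
  "Regular r = fAll (Field r) (\<lambda>\<alpha>. \<^bold>\<not> Cofinal_map r \<alpha>)"

text \<open>\<open>cf(\<lambda>) < \<lambda>\<close>\<close>

definition Singular :: "'a rel \<Rightarrow> 'p sentence" where
  "Singular r = fEx (Field r) (\<lambda>\<kappa>. Cf_eq r \<kappa>)"

text \<open>\<open>\<lambda>\<close> is an initial ordinal: it is not in bijection with any smaller ordinal.\<close>

definition Cardinal :: "'a rel \<Rightarrow> 'p sentence" where
  "Cardinal r = fAll (Field r) (\<lambda>\<alpha>. \<^bold>\<not> fEx_fun (underS r \<alpha>) (Field r) (\<lambda>h.
     fAll (underS r \<alpha>) (\<lambda>\<xi>. fAll (underS r \<alpha>) (\<lambda>\<xi>'. fAll (Field r) (\<lambda>\<eta>.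
       (((\<xi>, \<eta>) \<^bold>\<in> h) \<^bold>\<and> ((\<xi>', \<eta>) \<^bold>\<in> h)) \<^bold>\<longrightarrow> Ground (\<xi> = \<xi>')))) \<^bold>\<and>
     fAll (Field r) (\<lambda>\<eta>. fEx (underS r \<alpha>) (\<lambda>\<xi>. (\<xi>, \<eta>) \<^bold>\<in> h))))"

text \<open>
  There is a bijection from the ordinal \<open>\<mu>\<close> onto the power set of the ordinal \<open>\<kappa>\<close>.
  A function \<open>F\<close> from \<open>\<mu>\<close> to the power set of \<open>\<kappa>\<close> is given by the subset
  \<open>e = {(\<xi>, \<eta>). \<eta> \<in> F \<xi>}\<close> of \<open>\<mu> \<times> \<kappa>\<close>; the two conjuncts are injectivity and surjectivity.
\<close>

definition Bij_power :: "'a rel \<Rightarrow> 'a \<Rightarrow> 'a \<Rightarrow> 'p sentence" where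
  "Bij_power r \<mu> \<kappa> = fEx_sub (underS r \<mu> \<times> underS r \<kappa>) (\<lambda>e.
     fAll (underS r \<mu>) (\<lambda>\<xi>. fAll (underS r \<mu>) (\<lambda>\<xi>'.
       fAll (underS r \<kappa>) (\<lambda>\<eta>. ((\<xi>, \<eta>) \<^bold>\<in> e) \<^bold>\<longleftrightarrow> ((\<xi>', \<eta>) \<^bold>\<in> e)) \<^bold>\<longrightarrow> Ground (\<xi> = \<xi>'))) \<^bold>\<and>
     fAll_sub (underS r \<kappa>) (\<lambda>X. fEx (underS r \<mu>) (\<lambda>\<xi>.
       fAll (underS r \<kappa>) (\<lambda>\<eta>. (\<eta> \<^bold>\<in> X) \<^bold>\<longleftrightarrow> ((\<xi>, \<eta>) \<^bold>\<in> e)))))"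

text \<open>\<open>2\<^sup>\<kappa> = \<mu>\<close>, that is, \<open>\<mu>\<close> is the least ordinal equinumerous with the power set of \<open>\<kappa>\<close>.\<close>

definition Two_power_eq :: "'a rel \<Rightarrow> 'a \<Rightarrow> 'a \<Rightarrow> 'p sentence" where
  "Two_power_eq r \<kappa> \<mu> = (Bij_power r \<mu> \<kappa> \<^bold>\<and> fAll (underS r \<mu>) (\<lambda>\<nu>. \<^bold>\<not> Bij_power r \<nu> \<kappa>))"

text \<open>\<open>2^cf(\<lambda>) < \<lambda>\<close>, for singular \<open>\<lambda>\<close>\<close>

definition Two_power_cf_less :: "'a rel \<Rightarrow> 'p sentence" where
  "Two_power_cf_less r =
     fEx (Field r) (\<lambda>\<kappa>. Cf_eq r \<kappa> \<^bold>\<and> fEx (Field r) (\<lambda>\<mu>. Two_power_eq r \<kappa> \<mu>))"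

text \<open>
  There is a function \<open>g\<close> from \<open>\<lambda>\<close> to \<open>\<lambda>\<close> such that every \<open>f\<close> from \<open>\<lambda>\<close> to \<open>\<lambda>\<close> in the
  ground model satisfies \<open>f \<alpha> < g \<alpha>\<close> for some \<open>\<alpha> < \<lambda>\<close>.
\<close>

definition Unbounded_function :: "'a rel \<Rightarrow> 'p sentence" where
  "Unbounded_function r = fEx_fun (Field r) (Field r) (\<lambda>g.
     fAll (Func (Field r) (Field r)) (\<lambda>f. fEx (Field r) (\<lambda>\<alpha>. fEx (Field r) (\<lambda>\<beta>.
       ((\<alpha>, \<beta>) \<^bold>\<in> g) \<^bold>\<and> Ground (lt r (f \<alpha>) \<beta>)))))"


section \<open>The class \<open>C\<^sub>\<lambda>\<close>\<close>

definition Cofinal_subset :: "'a rel \<Rightarrow> ('a, 'p) sname \<Rightarrow> 'p sentence" where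
  "Cofinal_subset r L =
     fAll (Field r) (\<lambda>\<gamma>. fEx (Field r) (\<lambda>\<xi>. (\<xi> \<^bold>\<in> L) \<^bold>\<and> Ground ((\<gamma>, \<xi>) \<in> r)))"

text \<open>\<open>\<zeta> = min (L - (\<xi> + 1))\<close>\<close>

definition Next_elem :: "'a rel \<Rightarrow> ('a, 'p) sname \<Rightarrow> 'a \<Rightarrow> 'a \<Rightarrow> 'p sentence" where
  "Next_elem r L \<xi> \<zeta> = ((\<zeta> \<^bold>\<in> L) \<^bold>\<and> Ground (lt r \<xi> \<zeta>) \<^bold>\<and>
     fAll (Field r) (\<lambda>\<eta>. ((\<eta> \<^bold>\<in> L) \<^bold>\<and> Ground (lt r \<xi> \<eta>)) \<^bold>\<longrightarrow> Ground ((\<zeta>, \<eta>) \<in> r)))"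

definition Guessing_set :: "'a rel \<Rightarrow> 'p sentence" where
  "Guessing_set r = fEx_sub (Field r) (\<lambda>L. Cofinal_subset r L \<^bold>\<and>
     fAll (Func (Field r) (Field r)) (\<lambda>f. fEx (Field r) (\<lambda>\<xi>. (\<xi> \<^bold>\<in> L) \<^bold>\<and>
       fEx (Field r) (\<lambda>\<zeta>. Next_elem r L \<xi> \<zeta> \<^bold>\<and> Ground (lt r (f \<xi>) \<zeta>)))))"

definition in_class_C :: "'a rel \<Rightarrow> 'p rel \<Rightarrow> bool" where
  "in_class_C r Q \<longleftrightarrow> notion_of_forcing Q \<and>
     chain_condition (cardSuc r) Q \<and> |Field Q| \<le>o ctwo ^c r \<and> forced Q (Guessing_set r)"

end

theory Submission
  imports Defs
begin

text \<open>
  If \<open>\<lambda>\<close> stays regular and \<open>g\<close> is not bounded by a ground model function, let \<open>\<Lambda>\<close> be chosen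
  greedily so that \<open>g \<alpha> < \<zeta>\<close> whenever \<open>\<alpha> \<le> \<xi> < \<zeta>\<close> with \<open>\<xi>, \<zeta> \<in> \<Lambda>\<close>.  If some \<open>f\<close> satisfied
  \<open>min (\<Lambda> - (\<xi> + 1)) \<le> f \<xi>\<close> for all \<open>\<xi> \<in> \<Lambda>\<close>, then \<open>g\<close> would be bounded by \<open>F \<circ> F\<close>, where
  \<open>F \<alpha> = sup (f ` (\<alpha> + 1))\<close>.

  In the two singular cases let \<open>h : \<kappa> \<rightarrow> \<lambda>\<close> be cofinal in the extension with \<open>\<kappa> < \<lambda>\<close>, and suppose
  that there is no guessing set.  In the ground model define \<open>f\<^sub>i\<close> for \<open>i < \<lambda>\<close> by recursion: let
  \<open>D\<^sub>i\<close> be the club of ordinals closed under all \<open>f\<^sub>j\<close> with \<open>j < i\<close>, and \<open>\<pi>\<^sub>i y\<close> the largest element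
  of \<open>D\<^sub>i\<close> below or equal to \<open>y\<close>.  The cofinal set \<open>\<pi>\<^sub>i[ran h]\<close> is not guessing, and by the
  \<open>\<lambda>\<^sup>+\<close>-chain condition this is witnessed eventually by one ground model function, \<open>f\<^sub>i\<close>.  If \<open>\<pi>\<^sub>i\<close>
  and \<open>\<pi>\<^sub>i\<^sub>+\<^sub>1\<close> agreed on the range of \<open>h\<close>, the elements of \<open>\<pi>\<^sub>i[ran h]\<close> would be closed under
  \<open>f\<^sub>i\<close>, a contradiction.  So for each \<open>i\<close> there is \<open>l < \<kappa>\<close> with \<open>\<pi>\<^sub>i\<^sub>+\<^sub>1 (h l) < \<pi>\<^sub>i (h l)\<close>; for fixed
  \<open>l\<close> this happens only finitely often because the values decrease.  Hence the extension contains a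
  surjection from \<open>\<kappa> \<times> \<omega>\<close>, and so from \<open>\<kappa>\<close>, onto \<open>\<lambda>\<close>.  This is impossible if \<open>\<lambda>\<close> is
  a cardinal there, and by Cantor's theorem also if \<open>2\<^sup>\<kappa> < \<lambda>\<close>.
\<close>

section \<open>Forcing over a preorder\<close>

locale forcing_poset =
  fixes Q :: "'p rel"
  assumes notion: "notion_of_forcing Q"
begin

lemma Q_refl: "p \<in> Field Q \<Longrightarrow> (p, p) \<in> Q"
  using notion by (auto simp: notion_of_forcing_def preorder_on_def refl_on_def)

lemma Q_trans: "(s, q) \<in> Q \<Longrightarrow> (q, p) \<in> Q \<Longrightarrow> (s, p) \<in> Q"
  using notion by (auto simp: notion_of_forcing_def preorder_on_def dest: transD)

lemma Q_Field: "(q, p) \<in> Q \<Longrightarrow> q \<in> Field Q \<and> p \<in> Field Q"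
  by (auto simp: Field_def)

lemma mem_mono: "(a \<^bold>\<in> \<tau>) Q p \<Longrightarrow> (q, p) \<in> Q \<Longrightarrow> (a \<^bold>\<in> \<tau>) Q q"
  unfolding fMem_def using Q_trans by blast

text \<open>A ground model statement holds at all conditions or at none, so the conclusion requires
  no passage to a stronger condition.\<close>

lemma imp_Ground_iff:
  "(\<phi> \<^bold>\<longrightarrow> Ground b) Q p \<longleftrightarrow> (\<forall>q. (q, p) \<in> Q \<longrightarrow> \<phi> Q q \<longrightarrow> b)"
  unfolding fImp_def fNot_def fAnd_def Ground_def using Q_refl Q_Field by blast

text \<open>Defines a subset of the extension by a predicate on conditions: for \<open>P\<close>
  stable under strengthening, \<open>a\<close> belongs to it when \<open>P s a\<close> holds for
  some \<open>s\<close> in the generic filter.\<close>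

definition name_of :: "'b set \<Rightarrow> ('p \<Rightarrow> 'b \<Rightarrow> bool) \<Rightarrow> ('b, 'p) sname" where
  "name_of A P = {(a, s). a \<in> A \<and> s \<in> Field Q \<and> P s a}"

lemma name_of_names: "name_of A P \<in> names Q A"
  by (auto simp: name_of_def names_def)

lemma mem_name_ofI:
  assumes "P s a" "a \<in> A" "s \<in> Field Q"
  shows "(a \<^bold>\<in> name_of A P) Q s"
  unfolding fMem_def name_of_def using assms Q_refl Q_Field by blast

text \<open>Forced membership only means that the conditions below some pair of the name are dense;
  \<open>s'\<close> is one of them, and \<open>P\<close> passes down to it by stability.\<close>

lemma mem_name_ofD:
  assumes "(a \<^bold>\<in> name_of A P) Q s" "s \<in> Field Q"
    and "\<And>s s' a. P s a \<Longrightarrow> (s', s) \<in> Q \<Longrightarrow> P s' a"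
  obtains s' where "(s', s) \<in> Q" "a \<in> A" "P s' a"
  using assms Q_refl unfolding fMem_def name_of_def by blast

text \<open>For uniqueness, some extension of \<open>q\<close> fixes one value against all
  competitors; both \<open>b\<close> and \<open>b'\<close> are still forced there and equal
  it.\<close>

lemma is_funD:
  assumes "is_fun A B h Q p" "a \<in> A"
  shows is_fun_total: "(q, p) \<in> Q \<Longrightarrow> \<exists>s b. (s, q) \<in> Q \<and> b \<in> B \<and> ((a, b) \<^bold>\<in> h) Q s"
    and is_fun_unique: "(q, p) \<in> Q \<Longrightarrow> ((a, b) \<^bold>\<in> h) Q q \<Longrightarrow> ((a, b') \<^bold>\<in> h) Q q \<Longrightarrow>
      b \<in> B \<Longrightarrow> b' \<in> B \<Longrightarrow> b = b'"
proof -
  have *: "\<exists>s b. (s, q) \<in> Q \<and> b \<in> B \<and> ((a, b) \<^bold>\<in> h) Q s \<and>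
      (\<forall>b'\<in>B. \<forall>q'. (q', s) \<in> Q \<longrightarrow> ((a, b') \<^bold>\<in> h) Q q' \<longrightarrow> b' = b)" if "(q, p) \<in> Q" for q
    using assms that
    unfolding is_fun_def fAll_def fEx_iff fAnd_def[of _ "\<lambda>_ _. \<forall>_\<in>_. _ _ _ _"] imp_Ground_iff
    by (fastforce simp: fAnd_def imp_Ground_iff)
  show "(q, p) \<in> Q \<Longrightarrow> \<exists>s b. (s, q) \<in> Q \<and> b \<in> B \<and> ((a, b) \<^bold>\<in> h) Q s"
    using * by blast
  show "(q, p) \<in> Q \<Longrightarrow> ((a, b) \<^bold>\<in> h) Q q \<Longrightarrow> ((a, b') \<^bold>\<in> h) Q q \<Longrightarrow>
      b \<in> B \<Longrightarrow> b' \<in> B \<Longrightarrow> b = b'"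
    using * mem_mono Q_refl Q_Field by metis
qed

lemma is_funI:
  assumes "\<And>q a. (q, p) \<in> Q \<Longrightarrow> a \<in> A \<Longrightarrow> \<exists>s b. (s, q) \<in> Q \<and> b \<in> B \<and> ((a, b) \<^bold>\<in> h) Q s"
    and "\<And>q a b b'. (q, p) \<in> Q \<Longrightarrow> a \<in> A \<Longrightarrow> b \<in> B \<Longrightarrow> b' \<in> B \<Longrightarrow>
      ((a, b) \<^bold>\<in> h) Q q \<Longrightarrow> ((a, b') \<^bold>\<in> h) Q q \<Longrightarrow> b' = b"
  shows "is_fun A B h Q p"
proof -
  have "\<exists>s. (s, q) \<in> Q \<and> (\<exists>b\<in>B. ((a, b) \<^bold>\<in> h) Q s \<and>
      (\<forall>b'\<in>B. \<forall>q'. (q', s) \<in> Q \<longrightarrow> ((a, b') \<^bold>\<in> h) Q q' \<longrightarrow> b' = b))"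
    if qa: "(q, p) \<in> Q" "a \<in> A" for q a
  proof -
    obtain s b where "(s, q) \<in> Q" "b \<in> B" "((a, b) \<^bold>\<in> h) Q s"
      using assms(1)[OF qa] by blast
    then show ?thesis
      using assms(2) qa mem_mono Q_trans by (metis (no_types, lifting))
  qed
  then show ?thesis
    unfolding is_fun_def fAll_def fEx_iff by (simp add: fAnd_def imp_Ground_iff)
qed

lemma is_fun_mono: "is_fun A B h Q p \<Longrightarrow> (q, p) \<in> Q \<Longrightarrow> is_fun A B h Q q"
  unfolding is_fun_def fAll_def fEx_iff using Q_trans by blast

text \<open>Two forced memberships are realised by \<open>P\<close> one after the other, hence both
  at a common extension, where \<open>unique\<close> applies.\<close>

lemma is_fun_name_of:
  assumes mono: "\<And>s s' ab. P s ab \<Longrightarrow> (s', s) \<in> Q \<Longrightarrow> P s' ab"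
    and total: "\<And>q a. (q, p) \<in> Q \<Longrightarrow> a \<in> A \<Longrightarrow> \<exists>s b. (s, q) \<in> Q \<and> b \<in> B \<and> P s (a, b)"
    and unique: "\<And>q a b b'. (q, p) \<in> Q \<Longrightarrow> P q (a, b) \<Longrightarrow> P q (a, b') \<Longrightarrow> b = b'"
  shows "is_fun A B (name_of (A \<times> B) P) Q p"
proof (rule is_funI)
  fix q a assume "(q, p) \<in> Q" "a \<in> A"
  then obtain s b where "(s, q) \<in> Q" "b \<in> B" "P s (a, b)" using total by blast
  then show "\<exists>s b. (s, q) \<in> Q \<and> b \<in> B \<and> ((a, b) \<^bold>\<in> name_of (A \<times> B) P) Q s"
    using \<open>a \<in> A\<close> mem_name_ofI[of P s "(a, b)" "A \<times> B"] Q_Field by blast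
next
  fix q a b b'
  assume *: "(q, p) \<in> Q" "((a, b) \<^bold>\<in> name_of (A \<times> B) P) Q q" "((a, b') \<^bold>\<in> name_of (A \<times> B) P) Q q"
  obtain s where s: "(s, q) \<in> Q" "P s (a, b)"
    using mem_name_ofD[OF *(2)] mono Q_Field *(1) by metis
  obtain s' where s': "(s', s) \<in> Q" "P s' (a, b')"
    using mem_name_ofD[OF mem_mono[OF *(3) s(1)]] mono Q_Field s(1) by metis
  show "b' = b"
    using unique[of s' a b' b] s s' mono Q_trans *(1) by blast
qed

text \<open>The values are decided one at a time, each by a stronger condition; after finitely many
  steps one condition decides all.\<close>

lemma finite_fun_decided:
  assumes "is_fun A B h Q p" "finite C" "C \<subseteq> A" "p \<in> Field Q"
  shows "\<exists>s v. (s, p) \<in> Q \<and> (\<forall>a\<in>C. v a \<in> B \<and> ((a, v a) \<^bold>\<in> h) Q s)"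
  using assms(2,3)
proof (induction C)
  case empty
  then show ?case using Q_refl assms(4) by auto
next
  case (insert c C)
  then obtain s v where s: "(s, p) \<in> Q" "\<forall>a\<in>C. v a \<in> B \<and> ((a, v a) \<^bold>\<in> h) Q s" by blast
  obtain s' b where s': "(s', s) \<in> Q" "b \<in> B" "((c, b) \<^bold>\<in> h) Q s'"
    using is_fun_total[OF assms(1) _ s(1)] insert by blast
  have "\<forall>a\<in>insert c C. (v(c := b)) a \<in> B \<and> ((a, (v(c := b)) a) \<^bold>\<in> h) Q s'"
    using s s' mem_mono by (metis fun_upd_apply insert_iff)
  then show ?case using s s' Q_trans by blast
qed

text \<open>Zorn's lemma gives an antichain maximal among those inside \<open>D\<close>; a member of
  \<open>D\<close> incompatible with all of it could be added.\<close>

lemma maximal_antichain: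
  assumes "D \<subseteq> Field Q"
  shows "\<exists>A. antichain Q A \<and> A \<subseteq> D \<and> (\<forall>d\<in>D. \<exists>a\<in>A. compatible Q d a)"
proof -
  let ?\<A> = "{A. antichain Q A \<and> A \<subseteq> D}"
  have "\<exists>M\<in>?\<A>. \<forall>X\<in>?\<A>. M \<subseteq> X \<longrightarrow> X = M"
  proof (rule subset_Zorn')
    fix C assume C: "subset.chain ?\<A> C"
    have "\<not> compatible Q a b" if "X \<in> C" "a \<in> X" "Y \<in> C" "b \<in> Y" "a \<noteq> b" for a b X Y
    proof -
      have "X \<subseteq> Y \<or> Y \<subseteq> X" "antichain Q X" "antichain Q Y"
        using C that unfolding subset.chain_def by blast+
      then show ?thesis using that unfolding antichain_def by blast
    qed
    then show "\<Union>C \<in> ?\<A>"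
      using C assms by (auto simp: subset.chain_def antichain_def)
  qed
  then obtain A where A: "antichain Q A" "A \<subseteq> D"
    and "\<forall>X\<in>?\<A>. A \<subseteq> X \<longrightarrow> X = A" by auto
  then have max: "\<And>X. antichain Q X \<Longrightarrow> X \<subseteq> D \<Longrightarrow> A \<subseteq> X \<Longrightarrow> X = A"
    by simp
  have "\<exists>a\<in>A. compatible Q d a" if d: "d \<in> D" for d
  proof (rule ccontr)
    assume *: "\<not> (\<exists>a\<in>A. compatible Q d a)"
    have sym: "compatible Q a b \<Longrightarrow> compatible Q b a" for a b
      by (auto simp: compatible_def)
    have "antichain Q (insert d A)"
      using A * d assms sym unfolding antichain_def by blast
    then have "d \<in> A" using max A d by blast
    then show False using * Q_refl d assms by (auto simp: compatible_def)
  qed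
  with A show ?thesis by blast
qed

lemma imp_iff: "(\<phi> \<^bold>\<longrightarrow> \<psi>) Q p \<longleftrightarrow> (\<forall>q. (q, p) \<in> Q \<longrightarrow> \<phi> Q q \<longrightarrow> (\<exists>s. (s, q) \<in> Q \<and> \<psi> Q s))"
  unfolding fImp_def fNot_def fAnd_def by blast

lemma fAllD: "fAll A \<phi> Q p \<Longrightarrow> a \<in> A \<Longrightarrow> \<phi> a Q p"
  by (simp add: fAll_def)

lemma fNotD: "(\<^bold>\<not> \<phi>) Q p \<Longrightarrow> p \<in> Field Q \<Longrightarrow> \<phi> Q p \<Longrightarrow> False"
  unfolding fNot_def using Q_refl by blast

text \<open>Two successive extensions merge into one. Conversely, a witness found at
  \<open>s\<close> persists below \<open>s\<close>, which is where stability of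
  \<open>\<phi>\<close> enters.\<close>

lemma fEx2_iff:
  assumes "\<And>a b p q. a \<in> A \<Longrightarrow> b \<in> B \<Longrightarrow> \<phi> a b Q p \<Longrightarrow> (q, p) \<in> Q \<Longrightarrow> \<phi> a b Q q"
  shows "fEx A (\<lambda>a. fEx B (\<lambda>b. \<phi> a b)) Q p \<longleftrightarrow>
    (\<forall>q. (q, p) \<in> Q \<longrightarrow> (\<exists>s. (s, q) \<in> Q \<and> (\<exists>a\<in>A. \<exists>b\<in>B. \<phi> a b Q s)))"
proof
  assume L: "fEx A (\<lambda>a. fEx B (\<lambda>b. \<phi> a b)) Q p"
  show "\<forall>q. (q, p) \<in> Q \<longrightarrow> (\<exists>s. (s, q) \<in> Q \<and> (\<exists>a\<in>A. \<exists>b\<in>B. \<phi> a b Q s))"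
  proof (intro allI impI)
    fix q assume "(q, p) \<in> Q"
    with L obtain s a where "(s, q) \<in> Q" "a \<in> A" "fEx B (\<lambda>b. \<phi> a b) Q s"
      unfolding fEx_iff[of A] by blast
    moreover then obtain t b where "(t, s) \<in> Q" "b \<in> B" "\<phi> a b Q t"
      using Q_refl Q_Field unfolding fEx_iff by blast
    ultimately show "\<exists>s. (s, q) \<in> Q \<and> (\<exists>a\<in>A. \<exists>b\<in>B. \<phi> a b Q s)"
      using Q_trans by blast
  qed
next
  assume R: "\<forall>q. (q, p) \<in> Q \<longrightarrow> (\<exists>s. (s, q) \<in> Q \<and> (\<exists>a\<in>A. \<exists>b\<in>B. \<phi> a b Q s))"
  show "fEx A (\<lambda>a. fEx B (\<lambda>b. \<phi> a b)) Q p"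
    unfolding fEx_iff[of A]
  proof (intro allI impI)
    fix q assume "(q, p) \<in> Q"
    with R obtain s a b where *: "(s, q) \<in> Q" "a \<in> A" "b \<in> B" "\<phi> a b Q s" by blast
    then have "fEx B (\<lambda>b. \<phi> a b) Q s"
      unfolding fEx_iff using assms Q_refl Q_Field by blast
    with * show "\<exists>s. (s, q) \<in> Q \<and> (\<exists>a\<in>A. fEx B (\<phi> a) Q s)" by blast
  qed
qed

end

section \<open>Regular uncountable cardinals\<close>

text \<open>An infinite set has the size of its product with \<omega>. This later turns a surjection
  from \<kappa> \<times> \<omega> into one from \<kappa>.\<close>

lemma infinite_pairing:
  assumes "infinite A"
  shows "\<exists>\<pi> :: 'b \<Rightarrow> 'b \<times> nat. \<pi> ` A = A \<times> UNIV"
proof -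
  have "|UNIV :: nat set| \<le>o |A|" using assms infinite_iff_card_of_nat by blast
  then have "|A \<times> (UNIV :: nat set)| =o |A|" using card_of_Times_infinite[OF assms] by blast
  then have "|A \<times> (UNIV :: nat set)| \<le>o |A|" by (rule ordIso_imp_ordLeq)
  moreover have "A \<times> (UNIV :: nat set) \<noteq> {}" using assms by auto
  ultimately show ?thesis using card_of_ordLeq2[of "A \<times> (UNIV :: nat set)" A] by blast
qed

locale ground_cardinal =
  fixes r :: "'a rel"
  assumes card: "Card_order r" and reg: "regularCard r" and unc: "natLeq <o r"
begin

lemma wo: "wo_rel r" using card unfolding wo_rel_def by (auto simp: card_order_on_def)

lemma r_Field: "(x, y) \<in> r \<Longrightarrow> x \<in> Field r \<and> y \<in> Field r" by (auto simp: Field_def)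

lemma r_refl: "x \<in> Field r \<Longrightarrow> (x, x) \<in> r"
  using wo_rel.REFL[OF wo] by (auto simp: refl_on_def)
lemma r_trans: "(x, y) \<in> r \<Longrightarrow> (y, z) \<in> r \<Longrightarrow> (x, z) \<in> r"
  using wo_rel.TRANS[OF wo] by (auto dest: transD)
lemma r_antisym: "(x, y) \<in> r \<Longrightarrow> (y, x) \<in> r \<Longrightarrow> x = y"
  using wo_rel.ANTISYM[OF wo] by (auto dest: antisymD)
lemma lt_iff: "lt r x y \<longleftrightarrow> (x, y) \<in> r \<and> x \<noteq> y"
  by (auto simp: lt_def underS_def)
lemma not_le: "x \<in> Field r \<Longrightarrow> y \<in> Field r \<Longrightarrow> (x, y) \<notin> r \<longleftrightarrow> lt r y x"
  using wo_rel.TOTALS[OF wo] r_refl r_antisym lt_iff by metis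
lemma lt_le_trans: "lt r x y \<Longrightarrow> (y, z) \<in> r \<Longrightarrow> lt r x z"
  using r_trans r_antisym lt_iff by metis
lemma le_lt_trans: "(x, y) \<in> r \<Longrightarrow> lt r y z \<Longrightarrow> lt r x z"
  using r_trans r_antisym lt_iff by metis
lemma lt_Field: "lt r x y \<Longrightarrow> x \<in> Field r \<and> y \<in> Field r"
  using lt_iff r_Field by blast
lemma underS_iff: "x \<in> underS r y \<longleftrightarrow> lt r x y" by (simp add: lt_def)

lemma wf_lt: "wf (r - Id)" using wo_rel.WF[OF wo] .

lemma least:
  assumes "x \<in> Field r" "P x"
  obtains m where "m \<in> Field r" "P m" "\<And>y. lt r y m \<Longrightarrow> \<not> P y"
proof -
  obtain m where "m \<in> {y \<in> Field r. P y}" "\<And>y. (y, m) \<in> r - Id \<Longrightarrow> y \<notin> {y \<in> Field r. P y}"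
    using wfE_min[OF wf_lt, of x "{y \<in> Field r. P y}"] assms by blast
  then show ?thesis using that lt_iff lt_Field by blast
qed

lemma infinite_Field: "\<not> finite (Field r)"
  using unc card infinite_iff_natLeq_ordLeq card_of_Field_ordIso ordLess_imp_ordLeq
    ordIso_iff_ordLeq ordLeq_transitive by metis

lemma bounded:
  assumes K: "K \<subseteq> Field r" "|K| <o r"
  obtains b where "b \<in> Field r" "\<And>k. k \<in> K \<Longrightarrow> lt r k b"
proof -
  have "\<not> cofinal K r" 
    using reg K not_ordLess_ordIso unfolding regularCard_def by blast
  then obtain a where a: "a \<in> Field r" "\<And>b. b \<in> K \<Longrightarrow> a = b \<or> (a, b) \<notin> r"
    unfolding cofinal_def by blast
  \<comment> \<open>Since \<open>cofinal\<close> asks for strictly larger members, \<open>a\<close>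
    is only a weak upper bound of \<open>K\<close>; anything above \<open>a\<close> is a strict
    one.\<close>
  obtain b where "b \<in> Field r" "lt r a b"
    using infinite_Card_order_limit[OF card infinite_Field a(1)] lt_iff by blast
  moreover have "lt r k b" if "k \<in> K" for k
    using a that not_le K lt_le_trans le_lt_trans \<open>lt r a b\<close> r_refl lt_iff by (metis subsetD)
  ultimately show ?thesis using that by blast
qed

lemma finite_small: "finite K \<Longrightarrow> |K| <o r"
  using finite_ordLess_infinite[OF card_of_Well_order, of r K] infinite_Field wo
  by (simp add: wo_rel_def Field_card_of)

lemma underS_small: "|underS r x| <o r"
proof (cases "x \<in> Field r")
  case True
  then show ?thesis by (rule card_of_underS[OF card])
next
  case False
  then have "underS r x = {}" using lt_Field underS_iff by blast
  then show ?thesis by (simp add: finite_small)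
qed

lemma image_small: "|K| <o r \<Longrightarrow> |f ` K| <o r"
  by (rule ordLeq_ordLess_trans[OF card_of_image])

lemma Un_small: "|K| <o r \<Longrightarrow> |K'| <o r \<Longrightarrow> |K \<union> K'| <o r"
  by (rule card_of_Un_ordLess_infinite_Field[OF infinite_Field card])

lemma UN_small: "|I| <o r \<Longrightarrow> (\<And>i. i \<in> I \<Longrightarrow> |K i| <o r) \<Longrightarrow> |\<Union>i\<in>I. K i| <o r"
  using card_of_UNION_ordLess_infinite_Field_regularCard[of r I K] reg infinite_Field card
  by (simp add: cinfinite_def)

text \<open>Uncountability of \<lambda>, beyond mere infinity, enters here: it bounds the
  \<omega>-sequences that produce closure points.\<close>

lemma countable_small: "|range (z :: nat \<Rightarrow> 'b)| <o r"
  by (rule image_small) (rule ordIso_ordLess_trans[OF card_of_nat unc])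

lemma under_small: "x \<in> Field r \<Longrightarrow> |{y. (y, x) \<in> r}| <o r"
  using Un_small[OF underS_small[of x] finite_small[of "{x}"]]
  by (rule back_subst[of "\<lambda>A. |A| <o r"]) (auto simp: underS_def r_refl)

lemma no_max:
  assumes "x \<in> Field r" obtains y where "lt r x y"
  using infinite_Card_order_limit[OF card infinite_Field assms] lt_iff by blast

lemma upper_bound2:
  assumes "x \<in> Field r" "y \<in> Field r"
  obtains z where "lt r x z" "lt r y z"
proof (cases "(x, y) \<in> r")
  case True
  obtain z where "lt r y z" using no_max[OF assms(2)] .
  then show ?thesis using that[OF le_lt_trans[OF True]] by blast
next
  case False
  then have yx: "(y, x) \<in> r" using not_le[OF assms] lt_iff by blast
  obtain z where "lt r x z" using no_max[OF assms(1)] .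
  then show ?thesis using that[OF _ le_lt_trans[OF yx]] by blast
qed

text \<open>By regularity \<open>f\<close> is bounded on each initial segment; \<open>F y\<close> is
  a bound on the segment up to and including \<open>y\<close>.\<close>

lemma majorant:
  assumes "f \<in> Func (Field r) (Field r)"
  obtains F where "F \<in> Func (Field r) (Field r)" "\<forall>x y. (x, y) \<in> r \<longrightarrow> (f x, F y) \<in> r"
proof -
  have "\<exists>b. b \<in> Field r \<and> (\<forall>x. (x, y) \<in> r \<longrightarrow> lt r (f x) b)" if y: "y \<in> Field r" for y
    using bounded[OF _ image_small[OF under_small[OF y]], of f] assms r_Field
    unfolding Func_def by (smt (verit) image_iff image_subsetI mem_Collect_eq)
  then obtain F where F: "\<And>y. y \<in> Field r \<Longrightarrow> F y \<in> Field r \<and> (\<forall>x. (x, y) \<in> r \<longrightarrow> lt r (f x) (F y))"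
    by metis
  show ?thesis
    by (rule that[of "\<lambda>y. if y \<in> Field r then F y else undefined"])
      (use F r_Field lt_iff in \<open>auto simp: Func_def\<close>)
qed

text \<open>Infinitely many indices would give an infinite descent of values. The induction is on a
  strict bound \<open>v\<close> of the values: apart from the least index \<open>i\<close>, all
  indices in question have values below \<open>\<phi> i\<close>, which is itself below
  \<open>v\<close>.\<close>

lemma finite_strictly_decreasing:
  assumes S: "S \<subseteq> Field r" and dec: "\<And>i j. i \<in> S \<Longrightarrow> j \<in> S \<Longrightarrow> lt r i j \<Longrightarrow> lt r (\<phi> j) (\<phi> i)"
  shows "finite S"
proof -
  have first: "\<exists>i\<in>T. T \<subseteq> insert i {j \<in> S. lt r (\<phi> j) (\<phi> i)}" if T: "T \<subseteq> S" "T \<noteq> {}" for T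
  proof -
    obtain i where i: "i \<in> Field r" "i \<in> T" "\<And>j. lt r j i \<Longrightarrow> j \<notin> T"
      using least[of _ "\<lambda>i. i \<in> T"] T S by (metis ex_in_conv subsetD)
    have "lt r (\<phi> j) (\<phi> i)" if j: "j \<in> T" "j \<noteq> i" for j
    proof -
      have "j \<in> Field r" using j T S by blast
      then have "lt r i j" using i j not_le[of i j] lt_iff by blast
      then show ?thesis using dec i j T by blast
    qed
    with i T show ?thesis by blast
  qed
  have fin: "finite {j \<in> S. lt r (\<phi> j) v}" for v
    using wf_lt
  proof (induction v rule: wf_induct_rule)
    case (less v)
    show ?case
    proof (cases "{j \<in> S. lt r (\<phi> j) v} = {}")
      case True
      show ?thesis unfolding True by simp
    next
      case False
      have "{j \<in> S. lt r (\<phi> j) v} \<subseteq> S" by blast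
      from first[OF this False] obtain i where i: "lt r (\<phi> i) v"
        "{j \<in> S. lt r (\<phi> j) v} \<subseteq> insert i {j \<in> S. lt r (\<phi> j) (\<phi> i)}" by blast
      have "finite {j \<in> S. lt r (\<phi> j) (\<phi> i)}" using less i(1) lt_iff by blast
      then show ?thesis using i(2) by (meson finite.insertI finite_subset)
    qed
  qed
  show ?thesis
  proof (cases "S = {}")
    case False
    then obtain i where "S \<subseteq> insert i {j \<in> S. lt r (\<phi> j) (\<phi> i)}" using first[of S] by blast
    then show ?thesis using fin[of "\<phi> i"] by (meson finite.insertI finite_subset)
  qed simp
qed

section \<open>Closure points and the projection onto them\<close>

definition closed_under :: "('a \<Rightarrow> 'a) set \<Rightarrow> 'a set" where
  "closed_under F = {\<zeta> \<in> Field r. \<forall>f\<in>F. \<forall>\<alpha>. lt r \<alpha> \<zeta> \<longrightarrow> lt r (f \<alpha>) \<zeta>}"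

definition proj :: "('a \<Rightarrow> 'a) set \<Rightarrow> 'a \<Rightarrow> 'a" where
  "proj F y = (SOME z. z \<in> closed_under F \<and> (z, y) \<in> r \<and>
     (\<forall>w\<in>closed_under F. (w, y) \<in> r \<longrightarrow> (w, z) \<in> r))"

text \<open>The supremum \<open>z\<close> of the closure points up to \<open>y\<close> is a closure
  point: any \<alpha> below \<open>z\<close> lies below such a point \<open>w\<close>, so
  \<open>f \<alpha>\<close> does too. Without earlier closure points, \<open>z\<close> is the least
  ordinal, which is closed vacuously.\<close>

lemma proj:
  assumes y: "y \<in> Field r"
  shows "proj F y \<in> closed_under F \<and> (proj F y, y) \<in> r \<and>
    (\<forall>w\<in>closed_under F. (w, y) \<in> r \<longrightarrow> (w, proj F y) \<in> r)"
  unfolding proj_def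
proof (rule someI_ex)
  let ?ub = "\<lambda>z. \<forall>w\<in>closed_under F. (w, y) \<in> r \<longrightarrow> (w, z) \<in> r"
  obtain z where z: "z \<in> Field r" "?ub z" and min: "\<And>z'. lt r z' z \<Longrightarrow> \<not> ?ub z'"
    using least[of y ?ub] y by blast
  have "lt r (f \<alpha>) z" if "f \<in> F" "lt r \<alpha> z" for f \<alpha>
  proof -
    obtain w where w: "w \<in> closed_under F" "(w, y) \<in> r" "(w, \<alpha>) \<notin> r"
      using min \<open>lt r \<alpha> z\<close> by blast
    moreover have "\<alpha> \<in> Field r" "w \<in> Field r" using lt_Field[OF that(2)] w r_Field by blast+
    ultimately have "lt r \<alpha> w" using not_le by blast
    then have "lt r (f \<alpha>) w" using w that unfolding closed_under_def by blast
    then show ?thesis using w z lt_le_trans by blast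
  qed
  then have "z \<in> closed_under F" using z unfolding closed_under_def by blast
  moreover have "(z, y) \<in> r" using min not_le z y by blast
  ultimately show "\<exists>z. z \<in> closed_under F \<and> (z, y) \<in> r \<and> ?ub z" using z by blast
qed

lemma proj_antimono: "F \<subseteq> F' \<Longrightarrow> y \<in> Field r \<Longrightarrow> (proj F' y, proj F y) \<in> r"
  using proj[of y F] proj[of y F'] unfolding closed_under_def by blast

text \<open>\<open>B x\<close> bounds all values of the functions in \<open>F\<close> below
  \<open>x\<close>. The supremum of the \<omega> iterates of \<open>B\<close> from \<gamma> is
  closed: an argument below it is below some \<open>z n\<close>, so its values are below
  \<open>z (Suc n)\<close>.\<close>

lemma closed_under_unbounded:
  assumes F: "F \<subseteq> Func (Field r) (Field r)" "|F| <o r" and \<gamma>: "\<gamma> \<in> Field r"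
  shows "\<exists>\<zeta>\<in>closed_under F. (\<gamma>, \<zeta>) \<in> r"
proof -
  have "\<exists>b. b \<in> Field r \<and> (\<forall>f\<in>F. \<forall>\<alpha>. lt r \<alpha> x \<longrightarrow> lt r (f \<alpha>) b)" for x
  proof -
    have "|\<Union>f\<in>F. f ` underS r x| <o r"
      by (rule UN_small[OF F(2) image_small[OF underS_small]])
    moreover have "(\<Union>f\<in>F. f ` underS r x) \<subseteq> Field r"
      using F(1) lt_Field underS_iff unfolding Func_def by blast
    ultimately obtain b where "b \<in> Field r" "\<forall>k\<in>(\<Union>f\<in>F. f ` underS r x). lt r k b"
      using bounded by metis
    then show ?thesis using underS_iff by blast
  qed
  then obtain B where B: "\<And>x. B x \<in> Field r" "\<And>x f \<alpha>. f \<in> F \<Longrightarrow> lt r \<alpha> x \<Longrightarrow> lt r (f \<alpha>) (B x)"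
    by metis
  define z where "z n = (B ^^ n) \<gamma>" for n
  have zF: "range z \<subseteq> Field r"
  proof
    fix x assume "x \<in> range z"
    then obtain n where "x = z n" by blast
    then show "x \<in> Field r" by (cases n) (simp_all add: z_def \<gamma> B)
  qed
  let ?ub = "\<lambda>\<zeta>. \<forall>n. (z n, \<zeta>) \<in> r"
  obtain b where "b \<in> Field r" "\<forall>k\<in>range z. lt r k b"
    using bounded[OF zF countable_small] by metis
  then have "b \<in> Field r" "?ub b" using lt_iff by blast+
  then obtain \<zeta> where \<zeta>: "\<zeta> \<in> Field r" "?ub \<zeta>" and min: "\<And>y. lt r y \<zeta> \<Longrightarrow> \<not> ?ub y"
    using least[of b ?ub] by blast
  have "lt r (f \<alpha>) \<zeta>" if "f \<in> F" "lt r \<alpha> \<zeta>" for f \<alpha>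
  proof -
    obtain n where n: "(z n, \<alpha>) \<notin> r" using min \<open>lt r \<alpha> \<zeta>\<close> by blast
    have "z n \<in> Field r" "\<alpha> \<in> Field r" using zF lt_Field[OF that(2)] by blast+
    then have "lt r (f \<alpha>) (z (Suc n))" using n B(2)[OF that(1)] not_le by (simp add: z_def)
    then show ?thesis using \<zeta>(2) lt_le_trans by blast
  qed
  then have "\<zeta> \<in> closed_under F" using \<zeta> unfolding closed_under_def by blast
  moreover have "(\<gamma>, \<zeta>) \<in> r" using \<zeta>(2)[rule_format, of 0] by (simp add: z_def)
  ultimately show ?thesis by blast
qed

end

section \<open>Unbounded functions\<close>

locale forcing_ground = forcing_poset Q + ground_cardinal r
  for Q :: "'p rel" and r :: "'a rel"
begin

lemma Cofinal_map_iff: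
  "Cofinal_map r \<kappa> Q p \<longleftrightarrow> (\<forall>q. (q, p) \<in> Q \<longrightarrow>
    (\<exists>s h. (s, q) \<in> Q \<and> h \<in> names Q (underS r \<kappa> \<times> Field r) \<and> is_fun (underS r \<kappa>) (Field r) h Q s \<and>
      (\<forall>\<gamma>\<in>Field r. \<forall>t. (t, s) \<in> Q \<longrightarrow> (\<exists>u. (u, t) \<in> Q \<and>
        (\<exists>\<xi>\<in>underS r \<kappa>. \<exists>\<eta>\<in>Field r. ((\<xi>, \<eta>) \<^bold>\<in> h) Q u \<and> (\<gamma>, \<eta>) \<in> r)))))"
  unfolding Cofinal_map_def fEx_fun_def fEx_sub_iff
  apply (subst fAnd_def, subst fAll_def)
  apply (subst fEx2_iff)
  subgoal by (auto simp: fAnd_def Ground_def intro: mem_mono)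
  unfolding fAnd_def Ground_def by blast

lemma Unbounded_function_iff:
  "Unbounded_function r Q p \<longleftrightarrow> (\<forall>q. (q, p) \<in> Q \<longrightarrow>
    (\<exists>s g. (s, q) \<in> Q \<and> g \<in> names Q (Field r \<times> Field r) \<and> is_fun (Field r) (Field r) g Q s \<and>
      (\<forall>f\<in>Func (Field r) (Field r). \<forall>t. (t, s) \<in> Q \<longrightarrow> (\<exists>u. (u, t) \<in> Q \<and>
        (\<exists>\<alpha>\<in>Field r. \<exists>\<beta>\<in>Field r. ((\<alpha>, \<beta>) \<^bold>\<in> g) Q u \<and> lt r (f \<alpha>) \<beta>)))))"
  unfolding Unbounded_function_def fEx_fun_def fEx_sub_iff
  apply (subst fAnd_def, subst fAll_def)
  apply (subst fEx2_iff)
  subgoal by (auto simp: fAnd_def Ground_def intro: mem_mono)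
  unfolding fAnd_def Ground_def by blast

lemma Next_elem_iff:
  "Next_elem r L \<xi> \<zeta> Q p \<longleftrightarrow> (\<zeta> \<^bold>\<in> L) Q p \<and> lt r \<xi> \<zeta> \<and>
    (\<forall>\<eta>\<in>Field r. \<forall>q. (q, p) \<in> Q \<longrightarrow> (\<eta> \<^bold>\<in> L) Q q \<longrightarrow> lt r \<xi> \<eta> \<longrightarrow> (\<zeta>, \<eta>) \<in> r)"
proof -
  have "((\<lambda>Q p. \<phi> Q p \<and> b) \<^bold>\<longrightarrow> (\<lambda>Q p. c)) Q p \<longleftrightarrow> (\<forall>q. (q, p) \<in> Q \<longrightarrow> \<phi> Q q \<longrightarrow> b \<longrightarrow> c)"
    for \<phi> b c using imp_Ground_iff[of "\<lambda>Q p. \<phi> Q p \<and> b" c p] unfolding Ground_def by blast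
  then show ?thesis
    unfolding Next_elem_def fAnd_def Ground_def fAll_def by simp
qed

lemma Next_elem_mono: "Next_elem r L \<xi> \<zeta> Q p \<Longrightarrow> (q, p) \<in> Q \<Longrightarrow> Next_elem r L \<xi> \<zeta> Q q"
  unfolding Next_elem_iff using mem_mono Q_trans by metis

lemma Cofinal_subset_iff:
  "Cofinal_subset r L Q p \<longleftrightarrow> (\<forall>\<gamma>\<in>Field r. \<forall>q. (q, p) \<in> Q \<longrightarrow>
     (\<exists>s. (s, q) \<in> Q \<and> (\<exists>\<xi>\<in>Field r. (\<xi> \<^bold>\<in> L) Q s \<and> (\<gamma>, \<xi>) \<in> r)))"
  unfolding Cofinal_subset_def fAll_def fEx_iff fAnd_def Ground_def by blast

text \<open>Take the least \<zeta> above \<xi> that some condition below \<open>q\<close> forces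
  into \<open>L\<close>; minimality excludes smaller members at every further extension.\<close>

lemma next_elem_exists:
  assumes L: "Cofinal_subset r L Q p" and q: "(q, p) \<in> Q" and \<xi>: "\<xi> \<in> Field r"
  obtains s \<zeta> where "(s, q) \<in> Q" "Next_elem r L \<xi> \<zeta> Q s"
proof -
  let ?P = "\<lambda>\<zeta>. lt r \<xi> \<zeta> \<and> (\<exists>s. (s, q) \<in> Q \<and> (\<zeta> \<^bold>\<in> L) Q s)"
  obtain \<gamma> where \<gamma>: "lt r \<xi> \<gamma>" using no_max[OF \<xi>] .
  then obtain s \<eta> where "(s, q) \<in> Q" "(\<eta> \<^bold>\<in> L) Q s" "(\<gamma>, \<eta>) \<in> r"
    using L q lt_Field unfolding Cofinal_subset_iff by blast
  then have "?P \<eta>" "\<eta> \<in> Field r" using \<gamma> lt_le_trans r_Field by blast+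
  then obtain \<zeta> where \<zeta>: "\<zeta> \<in> Field r" "?P \<zeta>" and min: "\<And>y. lt r y \<zeta> \<Longrightarrow> \<not> ?P y"
    using least[of \<eta> ?P] by blast
  then obtain s where s: "(s, q) \<in> Q" "(\<zeta> \<^bold>\<in> L) Q s" by blast
  have "(\<zeta>, \<eta>) \<in> r" if "\<eta> \<in> Field r" "(t, s) \<in> Q" "(\<eta> \<^bold>\<in> L) Q t" "lt r \<xi> \<eta>" for \<eta> t
    using min that s(1) Q_trans not_le \<zeta>(1) by blast
  then have "Next_elem r L \<xi> \<zeta> Q s"
    unfolding Next_elem_iff using s \<zeta> by blast
  with s that show ?thesis by blast
qed

text \<open>Guessing with both \<xi> and its successor in \<open>L\<close> already decided by
  \<open>p\<close>; the forced statement then amounts to density of such conditions.\<close>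

definition guesses :: "('a, 'p) sname \<Rightarrow> ('a \<Rightarrow> 'a) \<Rightarrow> 'p \<Rightarrow> bool" where
  "guesses L f p \<longleftrightarrow> (\<exists>\<xi>\<in>Field r. \<exists>\<zeta>. (\<xi> \<^bold>\<in> L) Q p \<and> Next_elem r L \<xi> \<zeta> Q p \<and> lt r (f \<xi>) \<zeta>)"

lemma Guessing_setI:
  assumes "\<And>q. (q, p) \<in> Q \<Longrightarrow> \<exists>s L. (s, q) \<in> Q \<and> L \<in> names Q (Field r) \<and> Cofinal_subset r L Q s \<and>
    (\<forall>f\<in>Func (Field r) (Field r). \<forall>t. (t, s) \<in> Q \<longrightarrow> (\<exists>u. (u, t) \<in> Q \<and> guesses L f u))"
  shows "Guessing_set r Q p"
proof -
  have *: "(fEx (Field r) (\<lambda>\<xi>. (\<xi> \<^bold>\<in> L) \<^bold>\<and> fEx (Field r)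
       (\<lambda>\<zeta>. Next_elem r L \<xi> \<zeta> \<^bold>\<and> Ground (lt r (f \<xi>) \<zeta>)))) Q s"
    if f: "\<And>t. (t, s) \<in> Q \<Longrightarrow> \<exists>u. (u, t) \<in> Q \<and> guesses L f u" for L f s
    unfolding fEx_iff[of "Field r" _ Q s]
  proof (intro allI impI)
    fix t assume "(t, s) \<in> Q"
    with f obtain u \<xi> \<zeta> where u: "(u, t) \<in> Q" "\<xi> \<in> Field r" "(\<xi> \<^bold>\<in> L) Q u"
      "Next_elem r L \<xi> \<zeta> Q u" "lt r (f \<xi>) \<zeta>" unfolding guesses_def by blast
    have "fEx (Field r) (\<lambda>\<zeta>. Next_elem r L \<xi> \<zeta> \<^bold>\<and> Ground (lt r (f \<xi>) \<zeta>)) Q u"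
      unfolding fEx_iff fAnd_def Ground_def
      using Next_elem_mono[OF u(4)] u(5) lt_Field Q_refl Q_Field by blast
    with u show "\<exists>u. (u, t) \<in> Q \<and> (\<exists>\<xi>\<in>Field r. ((\<xi> \<^bold>\<in> L) \<^bold>\<and> fEx (Field r)
       (\<lambda>\<zeta>. Next_elem r L \<xi> \<zeta> \<^bold>\<and> Ground (lt r (f \<xi>) \<zeta>))) Q u)"
      unfolding fAnd_def by blast
  qed
  show ?thesis
    unfolding Guessing_set_def fEx_sub_iff
    apply (subst fAnd_def, subst fAll_def)
    using assms * by meson
qed

text \<open>The restriction of \<open>g\<close> to \<gamma> has a name, and regularity keeps it from
  being cofinal, so some extension decides a bound. For \<gamma> outside \<open>Field r\<close>
  there are no arguments to bound.\<close>

lemma regular_bounded: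
  assumes R: "Regular r Q p" and p: "p \<in> Field Q"
    and g: "is_fun (Field r) (Field r) g Q p" and q: "(q, p) \<in> Q"
  shows "\<exists>s b. (s, q) \<in> Q \<and> b \<in> Field r \<and>
    (\<forall>t \<alpha> \<beta>. (t, s) \<in> Q \<longrightarrow> lt r \<alpha> \<gamma> \<longrightarrow> \<beta> \<in> Field r \<longrightarrow> ((\<alpha>, \<beta>) \<^bold>\<in> g) Q t \<longrightarrow> lt r \<beta> b)"
proof (cases "\<gamma> \<in> Field r")
  case False
  moreover obtain b where "b \<in> Field r" using infinite_Field by fastforce
  ultimately show ?thesis using q Q_refl Q_Field lt_Field by blast
next
  case True
  have sub: "underS r \<gamma> \<subseteq> Field r" using lt_Field underS_iff by blast
  let ?P = "\<lambda>s ab. (s, q) \<in> Q \<and> (ab \<^bold>\<in> g) Q s \<and> ab \<in> Field r \<times> Field r"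
  let ?h = "name_of (underS r \<gamma> \<times> Field r) ?P"
  have mono: "?P s ab \<Longrightarrow> (s', s) \<in> Q \<Longrightarrow> ?P s' ab" for s s' ab
    using mem_mono Q_trans by metis
  have fn: "is_fun (underS r \<gamma>) (Field r) ?h Q q"
  proof (rule is_fun_name_of)
    fix s a assume "(s, q) \<in> Q" "a \<in> underS r \<gamma>"
    then obtain t b where "(t, s) \<in> Q" "b \<in> Field r" "((a, b) \<^bold>\<in> g) Q t"
      using is_fun_total[OF g] sub Q_trans q by blast
    then show "\<exists>t b. (t, s) \<in> Q \<and> b \<in> Field r \<and> ?P t (a, b)"
      using \<open>(s, q) \<in> Q\<close> \<open>a \<in> underS r \<gamma>\<close> sub Q_trans by blast
  next
    fix s a b b' assume "(s, q) \<in> Q" "?P s (a, b)" "?P s (a, b')"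
    then show "b = b'" using is_fun_unique[OF g] Q_trans q by blast
  qed (rule mono)
  have "\<not> Cofinal_map r \<gamma> Q q"
    using R True q unfolding Regular_def fAll_def fNot_def by blast
  then obtain q' where q': "(q', q) \<in> Q" and nc: "\<And>s h. (s, q') \<in> Q \<Longrightarrow>
      h \<in> names Q (underS r \<gamma> \<times> Field r) \<Longrightarrow> is_fun (underS r \<gamma>) (Field r) h Q s \<Longrightarrow>
      \<not> (\<forall>\<gamma>'\<in>Field r. \<forall>t. (t, s) \<in> Q \<longrightarrow> (\<exists>u. (u, t) \<in> Q \<and>
        (\<exists>\<xi>\<in>underS r \<gamma>. \<exists>\<eta>\<in>Field r. ((\<xi>, \<eta>) \<^bold>\<in> h) Q u \<and> (\<gamma>', \<eta>) \<in> r)))"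
    unfolding Cofinal_map_iff by blast
  have q'q': "(q', q') \<in> Q" using q' Q_Field Q_refl by blast
  obtain b t where b: "b \<in> Field r" "(t, q') \<in> Q" and
    nb: "\<And>u \<xi> \<eta>. (u, t) \<in> Q \<Longrightarrow> \<xi> \<in> underS r \<gamma> \<Longrightarrow> \<eta> \<in> Field r \<Longrightarrow> ((\<xi>, \<eta>) \<^bold>\<in> ?h) Q u \<Longrightarrow> (b, \<eta>) \<notin> r"
    using nc[OF q'q' name_of_names is_fun_mono[OF fn q']] by blast
  have tq: "(t, q) \<in> Q" using b q' Q_trans by blast
  show ?thesis
  proof (intro exI conjI allI impI, rule tq, rule b(1))
    fix u \<alpha> \<beta> assume *: "(u, t) \<in> Q" "lt r \<alpha> \<gamma>" "\<beta> \<in> Field r" "((\<alpha>, \<beta>) \<^bold>\<in> g) Q u"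
    have "((\<alpha>, \<beta>) \<^bold>\<in> ?h) Q u"
      by (rule mem_name_ofI) (use * tq Q_trans lt_Field underS_iff Q_Field in blast)+
    then show "lt r \<beta> b" using nb * underS_iff not_le b(1) by blast
  qed
qed

lemma unbounded_guessing:
  assumes R: "Regular r Q p" and U: "Unbounded_function r Q p"
  shows "Guessing_set r Q p"
proof (rule Guessing_setI)
  fix q assume "(q, p) \<in> Q"
  with U obtain p0 g where p0: "(p0, q) \<in> Q" and g: "is_fun (Field r) (Field r) g Q p0" and
    unb: "\<forall>f\<in>Func (Field r) (Field r). \<forall>t. (t, p0) \<in> Q \<longrightarrow> (\<exists>u. (u, t) \<in> Q \<and>
        (\<exists>\<alpha>\<in>Field r. \<exists>\<beta>\<in>Field r. ((\<alpha>, \<beta>) \<^bold>\<in> g) Q u \<and> lt r (f \<alpha>) \<beta>))"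
    unfolding Unbounded_function_iff by blast
  have p0F: "p0 \<in> Field Q" using p0 Q_Field by blast
  have R0: "Regular r Q p0"
    using R p0 \<open>(q, p) \<in> Q\<close> Q_trans unfolding Regular_def fAll_def fNot_def by meson
  let ?step = "\<lambda>G \<zeta> s. \<forall>\<xi> t. (\<xi>, \<zeta>) \<in> r - Id \<longrightarrow> (t, s) \<in> Q \<longrightarrow> G \<xi> t \<longrightarrow>
    (\<forall>u \<alpha> \<beta>. (u, t) \<in> Q \<longrightarrow> (\<alpha>, \<xi>) \<in> r \<longrightarrow> \<beta> \<in> Field r \<longrightarrow> ((\<alpha>, \<beta>) \<^bold>\<in> g) Q u \<longrightarrow> lt r \<beta> \<zeta>)"
  have "\<exists>G. \<forall>\<zeta>. G \<zeta> = ?step G \<zeta>"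
  proof (rule dependent_wf_choice[OF wf_lt])
    fix G G' :: "'a \<Rightarrow> 'p \<Rightarrow> bool" and \<zeta> H
    assume "\<And>z. (z, \<zeta>) \<in> r - Id \<Longrightarrow> G z = G' z"
    then have "?step G \<zeta> = ?step G' \<zeta>" by (intro ext iff_allI imp_cong refl) simp
    then show "(H = ?step G \<zeta>) = (H = ?step G' \<zeta>)" by simp
  qed simp
  then obtain G where "\<forall>\<zeta>. G \<zeta> = ?step G \<zeta>" by blast
  from fun_cong[OF spec[OF this]] have G: "G \<zeta> s \<longleftrightarrow> ?step G \<zeta> s" for \<zeta> s .
  have G_D: "lt r \<beta> \<zeta>" if "G \<zeta> s" "lt r \<xi> \<zeta>" "(t, s) \<in> Q" "G \<xi> t" "(u, t) \<in> Q"
    "(\<alpha>, \<xi>) \<in> r" "\<beta> \<in> Field r" "((\<alpha>, \<beta>) \<^bold>\<in> g) Q u" for \<alpha> \<beta> \<xi> \<zeta> s t u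
    using that(1)[unfolded G[of \<zeta>]] that(2-) lt_iff by blast
  have G_mono: "G \<zeta> t" if "G \<zeta> s" "(t, s) \<in> Q" for \<zeta> s t
    unfolding G[of \<zeta>]
  proof (intro allI impI)
    fix \<xi> v u \<alpha> \<beta>
    assume "(\<xi>, \<zeta>) \<in> r - Id" "(v, t) \<in> Q" "G \<xi> v" "(u, v) \<in> Q" "(\<alpha>, \<xi>) \<in> r" "\<beta> \<in> Field r"
      "((\<alpha>, \<beta>) \<^bold>\<in> g) Q u"
    then show "lt r \<beta> \<zeta>"
      using G_D[OF that(1), of \<xi> v u] Q_trans[OF _ that(2)] lt_iff by blast
  qed
  have G_gap: "lt r \<beta> \<zeta>" if "G \<xi> s" "G \<zeta> s" "lt r \<xi> \<zeta>" "(\<alpha>, \<xi>) \<in> r" "\<beta> \<in> Field r"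
    "((\<alpha>, \<beta>) \<^bold>\<in> g) Q s" "s \<in> Field Q" for \<alpha> \<beta> \<xi> \<zeta> s
    using G_D[OF that(2,3) _ that(1) _ that(4-6)] Q_refl[OF that(7)] by blast
  define L where "L = name_of (Field r) (\<lambda>s \<zeta>. G \<zeta> s)"
  have L_I: "G \<zeta> s \<Longrightarrow> \<zeta> \<in> Field r \<Longrightarrow> s \<in> Field Q \<Longrightarrow> (\<zeta> \<^bold>\<in> L) Q s" for \<zeta> s
    unfolding L_def by (rule mem_name_ofI)
  have L_D: "\<exists>t. (t, s) \<in> Q \<and> G \<zeta> t \<and> \<zeta> \<in> Field r" if "(\<zeta> \<^bold>\<in> L) Q s" "s \<in> Field Q" for \<zeta> s
    using mem_name_ofD[OF that[unfolded L_def]] G_mono by metis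
  have cof: "Cofinal_subset r L Q p0"
    unfolding Cofinal_subset_iff
  proof (intro ballI allI impI)
    fix \<gamma> q assume \<gamma>: "\<gamma> \<in> Field r" and q: "(q, p0) \<in> Q"
    obtain s b where s: "(s, q) \<in> Q" and b: "b \<in> Field r" and
      bd: "\<forall>t \<alpha> \<beta>. (t, s) \<in> Q \<longrightarrow> lt r \<alpha> \<gamma> \<longrightarrow> \<beta> \<in> Field r \<longrightarrow> ((\<alpha>, \<beta>) \<^bold>\<in> g) Q t \<longrightarrow> lt r \<beta> b"
      using regular_bounded[OF R0 p0F g q, of \<gamma>] by blast
    show "\<exists>s. (s, q) \<in> Q \<and> (\<exists>\<xi>\<in>Field r. (\<xi> \<^bold>\<in> L) Q s \<and> (\<gamma>, \<xi>) \<in> r)"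
    proof (rule ccontr)
      assume neg: "\<not> ?thesis"
      then have small: "lt r \<xi> \<gamma>" if "G \<xi> t" "(t, q) \<in> Q" "\<xi> \<in> Field r" for \<xi> t
        using that L_I Q_Field not_le \<gamma> by blast
      obtain \<zeta> where \<zeta>: "lt r b \<zeta>" "lt r \<gamma> \<zeta>"
        using upper_bound2[OF b \<gamma>] .
      have "G \<zeta> s"
        unfolding G[of \<zeta>]
      proof (intro allI impI)
        fix \<xi> t u \<alpha> \<beta>
        assume *: "(\<xi>, \<zeta>) \<in> r - Id" "(t, s) \<in> Q" "G \<xi> t" "(u, t) \<in> Q" "(\<alpha>, \<xi>) \<in> r"
          "\<beta> \<in> Field r" "((\<alpha>, \<beta>) \<^bold>\<in> g) Q u"
        then have "lt r \<xi> \<gamma>" using small s Q_trans r_Field by blast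
        then have "lt r \<beta> b" using bd * Q_trans le_lt_trans by blast
        then show "lt r \<beta> \<zeta>" using \<zeta> lt_le_trans lt_iff by blast
      qed
      then have "lt r \<zeta> \<gamma>" using small s \<zeta> lt_Field by blast
      then show False using \<zeta> lt_iff lt_le_trans by blast
    qed
  qed
  have "\<exists>u. (u, t) \<in> Q \<and> guesses L f u"
    if f: "f \<in> Func (Field r) (Field r)" and t: "(t, p0) \<in> Q" for f t
  proof (rule ccontr)
    assume neg: "\<not> (\<exists>u. (u, t) \<in> Q \<and> guesses L f u)"
    have low: "(\<zeta>, f \<xi>) \<in> r" if "(u, t) \<in> Q" "G \<xi> u" "\<xi> \<in> Field r" "Next_elem r L \<xi> \<zeta> Q u" for \<xi> \<zeta> u
    proof -
      have "(\<xi> \<^bold>\<in> L) Q u" using L_I that Q_Field by blast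
      then have "\<not> lt r (f \<xi>) \<zeta>" using neg that unfolding guesses_def by blast
      moreover have "f \<xi> \<in> Field r" using f that by (auto simp: Func_def)
      ultimately show ?thesis using not_le that(4) lt_Field Next_elem_iff by blast
    qed
    obtain F where F: "F \<in> Func (Field r) (Field r)" and maj: "\<forall>x y. (x, y) \<in> r \<longrightarrow> (f x, F y) \<in> r"
      using majorant[OF f] .
    \<comment> \<open>\<open>F\<close> is applied twice because two successors in the greedy set are
      taken: the first, \<zeta>, is at least \<alpha> and at most \<open>F \<alpha>\<close>; the
      second, \<zeta>', is above the value of \<open>g\<close> at \<alpha> and at most
      \<open>F (F \<alpha>)\<close>.\<close>
    define FF where "FF = (\<lambda>x. if x \<in> Field r then F (F x) else undefined)"
    have "FF \<in> Func (Field r) (Field r)" using F by (auto simp: FF_def Func_def)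
    then have "\<exists>u. (u, t) \<in> Q \<and>
        (\<exists>\<alpha>\<in>Field r. \<exists>\<beta>\<in>Field r. ((\<alpha>, \<beta>) \<^bold>\<in> g) Q u \<and> lt r (FF \<alpha>) \<beta>)"
      using unb t by blast
    then obtain u \<alpha> \<beta> where u: "(u, t) \<in> Q" and \<alpha>: "\<alpha> \<in> Field r" and \<beta>: "\<beta> \<in> Field r"
      and gu: "((\<alpha>, \<beta>) \<^bold>\<in> g) Q u" and lt: "lt r (F (F \<alpha>)) \<beta>"
      by (auto simp: FF_def)
    have uF: "u \<in> Field Q" using u Q_Field by blast
    \<comment> \<open>\<open>\<xi>\<close> is the largest element of the greedy set up to \<open>\<alpha>\<close>.\<close>
    have "\<exists>v \<xi>. (v, u) \<in> Q \<and> G \<xi> v \<and> (\<xi>, \<alpha>) \<in> r \<and>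
      (\<forall>w \<zeta>. (w, v) \<in> Q \<longrightarrow> G \<zeta> w \<longrightarrow> lt r \<xi> \<zeta> \<longrightarrow> (\<alpha>, \<zeta>) \<in> r)"
    proof (cases "G \<alpha> u")
      case True
      then show ?thesis using Q_refl[OF uF] r_refl[OF \<alpha>] lt_iff by blast
    next
      case False
      \<comment> \<open>If \<alpha> is rejected, some earlier member \<xi> sees a value \<beta>' of
        \<open>g\<close> with \<alpha> \<le> \<beta>'; every later member must exceed \<beta>', so
        none falls between \<xi> and \<alpha>.\<close>
      then obtain \<xi> v v' \<alpha>' \<beta>' where v: "lt r \<xi> \<alpha>" "(v', u) \<in> Q" "G \<xi> v'" "(v, v') \<in> Q"
        "(\<alpha>', \<xi>) \<in> r" "\<beta>' \<in> Field r" "((\<alpha>', \<beta>') \<^bold>\<in> g) Q v" "\<not> lt r \<beta>' \<alpha>"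
        unfolding G[of \<alpha>] using lt_iff by blast
      have "(\<alpha>, \<zeta>) \<in> r" if "(w, v) \<in> Q" "G \<zeta> w" "lt r \<xi> \<zeta>" for w \<zeta>
      proof -
        have "lt r \<beta>' \<zeta>"
        proof (rule G_gap[of \<xi> w \<zeta> \<alpha>'])
          show "G \<xi> w" using G_mono[OF v(3)] Q_trans[OF that(1) v(4)] by blast
          show "((\<alpha>', \<beta>') \<^bold>\<in> g) Q w" using mem_mono[OF v(7) that(1)] .
          show "w \<in> Field Q" using Q_Field[OF that(1)] by blast
        qed (fact that v)+
        moreover have "(\<alpha>, \<beta>') \<in> r" using not_le[OF \<alpha> v(6)] v(8) by blast
        ultimately show ?thesis using le_lt_trans[of \<alpha> \<beta>' \<zeta>] lt_iff by blast
      qed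
      moreover have "(v, u) \<in> Q" "G \<xi> v" "(\<xi>, \<alpha>) \<in> r"
        using Q_trans[OF v(4,2)] G_mono[OF v(3,4)] v(1) lt_iff by blast+
      ultimately show ?thesis by blast
    qed
    then obtain v \<xi> where v: "(v, u) \<in> Q" "G \<xi> v" "(\<xi>, \<alpha>) \<in> r"
      and above: "\<And>w \<zeta>. (w, v) \<in> Q \<Longrightarrow> G \<zeta> w \<Longrightarrow> lt r \<xi> \<zeta> \<Longrightarrow> (\<alpha>, \<zeta>) \<in> r" by blast
    have \<xi>: "\<xi> \<in> Field r" using v r_Field by blast
    have vp: "(v, p0) \<in> Q" using v u t Q_trans by blast
    obtain w \<zeta> where w: "(w, v) \<in> Q" "Next_elem r L \<xi> \<zeta> Q w"
      using next_elem_exists[OF cof vp \<xi>] .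
    then obtain w1 where w1: "(w1, w) \<in> Q" "G \<zeta> w1" "\<zeta> \<in> Field r"
      using L_D Q_Field unfolding Next_elem_iff by blast
    have w1v: "(w1, v) \<in> Q" using w w1 Q_trans by blast
    have "(\<zeta>, f \<xi>) \<in> r"
      using low[of w1 \<xi> \<zeta>] w1v v u w w1 \<xi> Q_trans G_mono Next_elem_mono by metis
    then have \<zeta>F: "(\<zeta>, F \<alpha>) \<in> r" using maj v(3) r_trans by blast
    have \<alpha>\<zeta>: "(\<alpha>, \<zeta>) \<in> r" using above[OF w1v w1(2)] w(2) unfolding Next_elem_iff by blast
    obtain x \<zeta>' where x: "(x, w1) \<in> Q" "Next_elem r L \<zeta> \<zeta>' Q x"
      using next_elem_exists[OF cof Q_trans[OF w1v vp] w1(3)] .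
    then obtain x1 where x1: "(x1, x) \<in> Q" "G \<zeta>' x1" "\<zeta>' \<in> Field r"
      using L_D Q_Field unfolding Next_elem_iff by blast
    have x1u: "(x1, u) \<in> Q" "(x1, w1) \<in> Q" using x x1 w1v v Q_trans by blast+
    have "(\<zeta>', f \<zeta>) \<in> r"
      using low[of x1 \<zeta> \<zeta>'] x1u u x x1 w1 Q_trans G_mono Next_elem_mono by metis
    then have "(\<zeta>', F (F \<alpha>)) \<in> r" using maj \<zeta>F r_trans by blast
    moreover have "lt r \<beta> \<zeta>'"
    proof (rule G_gap[of \<zeta> x1 \<zeta>' \<alpha>])
      show "lt r \<zeta> \<zeta>'" using x(2) unfolding Next_elem_iff by blast
      show "G \<zeta> x1" by (rule G_mono[OF w1(2) x1u(2)])
      show "((\<alpha>, \<beta>) \<^bold>\<in> g) Q x1" by (rule mem_mono[OF gu x1u(1)])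
      show "x1 \<in> Field Q" using Q_Field[OF x1(1)] by blast
    qed (fact x1(2) \<alpha>\<zeta> \<beta>)+
    ultimately show False using le_lt_trans[OF _ lt, of \<zeta>'] lt_iff r_antisym by blast
  qed
  then show "\<exists>s L. (s, q) \<in> Q \<and> L \<in> names Q (Field r) \<and> Cofinal_subset r L Q s \<and>
    (\<forall>f\<in>Func (Field r) (Field r). \<forall>t. (t, s) \<in> Q \<longrightarrow> (\<exists>u. (u, t) \<in> Q \<and> guesses L f u))"
    using p0 cof name_of_names unfolding L_def by blast
qed

end

section \<open>Short cofinal maps\<close>

text \<open>A finite nonempty \<open>R\<close>-path from \<open>x\<close> leads out of
  \<open>B\<close>. Such a path survives when \<open>R\<close> grows, as it does at stronger
  conditions.\<close>

inductive reach :: "('a \<Rightarrow> 'a \<Rightarrow> bool) \<Rightarrow> 'a set \<Rightarrow> 'a \<Rightarrow> bool" for R B where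
  leaves: "R x y \<Longrightarrow> y \<notin> B \<Longrightarrow> reach R B x"
| step: "R x y \<Longrightarrow> reach R B y \<Longrightarrow> reach R B x"

lemma reach_mono:
  assumes "reach R B x" "\<And>x y. R x y \<Longrightarrow> R' x y"
  shows "reach R' B x"
  using assms(1) by induction (use assms(2) in \<open>blast intro: reach.intros\<close>)+

locale cc_forcing_ground = forcing_ground Q r for Q :: "'p rel" and r :: "'a rel" +
  assumes cc: "chain_condition (cardSuc r) Q"
begin

text \<open>A maximal antichain of conditions with a witness has at most \<lambda> members, numbered
  by \<open>e\<close>. At \<alpha> only the fewer than \<lambda> witnesses with number up to
  \<alpha> are bounded, so \<open>F\<close> dominates each of them from its own number on.\<close>

lemma eventually_dominating:
  assumes dense: "\<And>s. (s, p) \<in> Q \<Longrightarrow> \<exists>t f. (t, s) \<in> Q \<and> f \<in> Func (Field r) (Field r) \<and> W f t"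
    and mono: "\<And>f s t. W f s \<Longrightarrow> (t, s) \<in> Q \<Longrightarrow> W f t"
  shows "\<exists>F\<in>Func (Field r) (Field r). \<forall>s. (s, p) \<in> Q \<longrightarrow> (\<exists>t f e. (t, s) \<in> Q \<and> e \<in> Field r \<and>
    f \<in> Func (Field r) (Field r) \<and> W f t \<and> (\<forall>\<alpha>. (e, \<alpha>) \<in> r \<longrightarrow> (f \<alpha>, F \<alpha>) \<in> r))"
proof -
  let ?D = "{t. (t, p) \<in> Q \<and> (\<exists>f\<in>Func (Field r) (Field r). W f t)}"
  have "?D \<subseteq> Field Q" using Q_Field by blast
  then obtain A where A: "antichain Q A" "A \<subseteq> ?D"
    and max: "\<forall>d\<in>?D. \<exists>a\<in>A. compatible Q d a"
    using maximal_antichain[of ?D] by blast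
  have "|A| <o cardSuc r" using cc A(1) unfolding chain_condition_def by blast
  then have "|A| \<le>o r" using cardSuc_ordLeq_ordLess[OF card card_of_Card_order] by blast
  then have "|A| \<le>o |Field r|"
    using ordLeq_ordIso_trans[OF _ ordIso_symmetric[OF card_of_Field_ordIso[OF card]]] by blast
  then obtain e where e: "inj_on e A" "e ` A \<subseteq> Field r"
    using card_of_ordLeq[of A "Field r"] by blast
  have "\<forall>a\<in>A. \<exists>f. f \<in> Func (Field r) (Field r) \<and> W f a" using A(2) by blast
  from bchoice[OF this] obtain f
    where f: "\<forall>a\<in>A. f a \<in> Func (Field r) (Field r) \<and> W (f a) a" by blast
  have "\<exists>b. b \<in> Field r \<and> (\<forall>a\<in>A. (e a, \<alpha>) \<in> r \<longrightarrow> lt r (f a \<alpha>) b)" if \<alpha>: "\<alpha> \<in> Field r" for \<alpha>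
  proof -
    let ?A = "{a \<in> A. (e a, \<alpha>) \<in> r}"
    have "inj_on e ?A" using e(1) by (rule inj_on_subset) blast
    moreover have "e ` ?A \<subseteq> {x. (x, \<alpha>) \<in> r}" by blast
    ultimately have "|?A| \<le>o |{x. (x, \<alpha>) \<in> r}|"
      using card_of_ordLeq[of ?A "{x. (x, \<alpha>) \<in> r}"] by blast
    then have "|(\<lambda>a. f a \<alpha>) ` ?A| <o r"
      by (rule image_small[OF ordLeq_ordLess_trans[OF _ under_small[OF \<alpha>]]])
    moreover have "(\<lambda>a. f a \<alpha>) ` ?A \<subseteq> Field r" using f \<alpha> unfolding Func_def by blast
    ultimately obtain b where "b \<in> Field r" "\<forall>k\<in>(\<lambda>a. f a \<alpha>) ` ?A. lt r k b"
      using bounded by metis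
    then show ?thesis by blast
  qed
  then have "\<forall>\<alpha>\<in>Field r. \<exists>b. b \<in> Field r \<and> (\<forall>a\<in>A. (e a, \<alpha>) \<in> r \<longrightarrow> lt r (f a \<alpha>) b)" by blast
  from bchoice[OF this] obtain F0 where F0:
    "\<forall>\<alpha>\<in>Field r. F0 \<alpha> \<in> Field r \<and> (\<forall>a\<in>A. (e a, \<alpha>) \<in> r \<longrightarrow> lt r (f a \<alpha>) (F0 \<alpha>))" by blast
  define F where "F \<alpha> = (if \<alpha> \<in> Field r then F0 \<alpha> else undefined)" for \<alpha>
  have "F \<in> Func (Field r) (Field r)" using F0 unfolding Func_def F_def by simp
  moreover have "\<exists>t f e. (t, s) \<in> Q \<and> e \<in> Field r \<and>
    f \<in> Func (Field r) (Field r) \<and> W f t \<and> (\<forall>\<alpha>. (e, \<alpha>) \<in> r \<longrightarrow> (f \<alpha>, F \<alpha>) \<in> r)"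
    if s: "(s, p) \<in> Q" for s
  proof -
    obtain t g where t: "(t, s) \<in> Q" "g \<in> Func (Field r) (Field r)" "W g t" using dense[OF s] by blast
    then have "t \<in> ?D" using Q_trans[OF t(1) s] by blast
    then obtain a u where a: "a \<in> A" "(u, t) \<in> Q" "(u, a) \<in> Q"
      using max unfolding compatible_def by blast
    have "(f a \<alpha>, F \<alpha>) \<in> r" if "(e a, \<alpha>) \<in> r" for \<alpha>
      using F0 a(1) that r_Field[OF that] lt_iff unfolding F_def by simp
    moreover have "W (f a) u" using f a mono by blast
    moreover have "e a \<in> Field r" using e a by blast
    ultimately show ?thesis using f a Q_trans[OF a(2) t(1)] by blast
  qed
  ultimately show ?thesis by blast
qed

section \<open>Projections of the range of a cofinal map\<close>

definition cofinal_name :: "'a \<Rightarrow> ('a \<times> 'a, 'p) sname \<Rightarrow> 'p \<Rightarrow> bool" where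
  "cofinal_name \<kappa> h p \<longleftrightarrow> (\<forall>\<gamma>\<in>Field r. \<forall>t. (t, p) \<in> Q \<longrightarrow> (\<exists>u. (u, t) \<in> Q \<and>
     (\<exists>\<xi>\<in>underS r \<kappa>. \<exists>\<eta>\<in>Field r. ((\<xi>, \<eta>) \<^bold>\<in> h) Q u \<and> (\<gamma>, \<eta>) \<in> r)))"

definition in_range :: "'a \<Rightarrow> ('a \<times> 'a, 'p) sname \<Rightarrow> 'p \<Rightarrow> 'a \<Rightarrow> bool" where
  "in_range \<kappa> h s y \<longleftrightarrow> y \<in> Field r \<and> (\<exists>\<xi>\<in>underS r \<kappa>. ((\<xi>, y) \<^bold>\<in> h) Q s)"

definition proj_name :: "'a \<Rightarrow> ('a \<times> 'a, 'p) sname \<Rightarrow> ('a \<Rightarrow> 'a) set \<Rightarrow> ('a, 'p) sname" where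
  "proj_name \<kappa> h F = name_of (Field r) (\<lambda>s z. \<exists>y. in_range \<kappa> h s y \<and> z = proj F y)"

lemma in_range_mono: "in_range \<kappa> h s y \<Longrightarrow> (t, s) \<in> Q \<Longrightarrow> in_range \<kappa> h t y"
  unfolding in_range_def using mem_mono[of _ h s t] by blast

lemma mem_proj_nameD:
  assumes "(z \<^bold>\<in> proj_name \<kappa> h F) Q s" "s \<in> Field Q"
  shows "\<exists>t y. (t, s) \<in> Q \<and> in_range \<kappa> h t y \<and> z = proj F y"
  using mem_name_ofD[OF assms[unfolded proj_name_def]] in_range_mono by metis

text \<open>Above \<gamma> there is a closure point \<zeta>, and above \<zeta> some \<open>y\<close>
  in the range; the projection of \<open>y\<close> is then still at least \<zeta>.\<close>

lemma cofinal_proj_name: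
  assumes h: "cofinal_name \<kappa> h p" and F: "F \<subseteq> Func (Field r) (Field r)" "|F| <o r"
  shows "Cofinal_subset r (proj_name \<kappa> h F) Q p"
  unfolding Cofinal_subset_iff
proof (intro ballI allI impI)
  fix \<gamma> q assume \<gamma>: "\<gamma> \<in> Field r" and q: "(q, p) \<in> Q"
  obtain \<zeta> where \<zeta>: "\<zeta> \<in> closed_under F" "(\<gamma>, \<zeta>) \<in> r" using closed_under_unbounded[OF F \<gamma>] by blast
  then obtain u y where u: "(u, q) \<in> Q" "in_range \<kappa> h u y" "(\<zeta>, y) \<in> r"
    using h q r_Field unfolding cofinal_name_def in_range_def by blast
  have yF: "y \<in> Field r" using u unfolding in_range_def by blast
  have z: "(\<zeta>, proj F y) \<in> r" using proj[OF yF] \<zeta> u by blast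
  have "(proj F y \<^bold>\<in> proj_name \<kappa> h F) Q u"
    unfolding proj_name_def by (rule mem_name_ofI) (use u z r_Field Q_Field in blast)+
  then show "\<exists>s. (s, q) \<in> Q \<and> (\<exists>\<xi>\<in>Field r. (\<xi> \<^bold>\<in> proj_name \<kappa> h F) Q s \<and> (\<gamma>, \<xi>) \<in> r)"
    using u z \<zeta> r_Field r_trans by metis
qed

text \<open>\<open>f\<close> eventually witnesses that \<open>proj_name \<kappa> h F\<close> is not a guessing set.\<close>

definition defeats :: "'a \<Rightarrow> ('a \<times> 'a, 'p) sname \<Rightarrow> 'p \<Rightarrow> ('a \<Rightarrow> 'a) set \<Rightarrow> ('a \<Rightarrow> 'a) \<Rightarrow> bool" where
  "defeats \<kappa> h p F f \<longleftrightarrow> (\<forall>s. (s, p) \<in> Q \<longrightarrow> (\<exists>t e. (t, s) \<in> Q \<and> e \<in> Field r \<and>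
     (\<forall>u \<xi> \<zeta>. (u, t) \<in> Q \<longrightarrow> (e, \<xi>) \<in> r \<longrightarrow> (\<xi> \<^bold>\<in> proj_name \<kappa> h F) Q u \<longrightarrow>
        Next_elem r (proj_name \<kappa> h F) \<xi> \<zeta> Q u \<longrightarrow> (\<zeta>, f \<xi>) \<in> r)))"

text \<open>Different conditions may have different unguessed functions; the chain condition merges
  them into one that dominates each eventually. Enlarging a function preserves the upper bound on
  the next element.\<close>

lemma defeats_exists:
  assumes neg: "\<And>s. (s, p) \<in> Q \<Longrightarrow> \<exists>t f. (t, s) \<in> Q \<and> f \<in> Func (Field r) (Field r) \<and>
    (\<forall>u. (u, t) \<in> Q \<longrightarrow> \<not> guesses (proj_name \<kappa> h F) f u)"
  shows "\<exists>f\<in>Func (Field r) (Field r). defeats \<kappa> h p F f"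
proof -
  let ?L = "proj_name \<kappa> h F"
  let ?W = "\<lambda>f t. \<forall>u. (u, t) \<in> Q \<longrightarrow> \<not> guesses ?L f u"
  have "\<exists>G\<in>Func (Field r) (Field r). \<forall>s. (s, p) \<in> Q \<longrightarrow> (\<exists>t f e. (t, s) \<in> Q \<and> e \<in> Field r \<and>
    f \<in> Func (Field r) (Field r) \<and> ?W f t \<and> (\<forall>\<alpha>. (e, \<alpha>) \<in> r \<longrightarrow> (f \<alpha>, G \<alpha>) \<in> r))"
  proof (rule eventually_dominating[where W = ?W])
    fix f s t assume "?W f s" "(t, s) \<in> Q"
    then show "?W f t" using Q_trans[of _ t s] by blast
  qed (rule neg)
  then obtain G where G: "G \<in> Func (Field r) (Field r)"
    and dom: "\<forall>s. (s, p) \<in> Q \<longrightarrow> (\<exists>t f e. (t, s) \<in> Q \<and> e \<in> Field r \<and>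
      f \<in> Func (Field r) (Field r) \<and> ?W f t \<and> (\<forall>\<alpha>. (e, \<alpha>) \<in> r \<longrightarrow> (f \<alpha>, G \<alpha>) \<in> r))" by blast
  have "defeats \<kappa> h p F G"
    unfolding defeats_def
  proof (intro allI impI)
    fix s assume "(s, p) \<in> Q"
    from dom[THEN spec, THEN mp, OF this]
    obtain t f e where t: "(t, s) \<in> Q" "e \<in> Field r" "f \<in> Func (Field r) (Field r)" "?W f t"
      "\<forall>\<alpha>. (e, \<alpha>) \<in> r \<longrightarrow> (f \<alpha>, G \<alpha>) \<in> r" by (elim exE conjE) (rule that)
    have "(\<zeta>, G \<xi>) \<in> r" if "(u, t) \<in> Q" "(e, \<xi>) \<in> r" "(\<xi> \<^bold>\<in> ?L) Q u" "Next_elem r ?L \<xi> \<zeta> Q u"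
      for u \<xi> \<zeta>
    proof -
      have F: "\<xi> \<in> Field r" "\<zeta> \<in> Field r" "f \<xi> \<in> Field r"
        using that(2,4) r_Field lt_Field t(3) unfolding Next_elem_iff Func_def by blast+
      then have "\<not> lt r (f \<xi>) \<zeta>" using t(4) that(1,3,4) unfolding guesses_def by blast
      then have "(\<zeta>, f \<xi>) \<in> r" using not_le F by blast
      then show ?thesis using t(5) that(2) r_trans by blast
    qed
    with t(1,2) show "\<exists>t e. (t, s) \<in> Q \<and> e \<in> Field r \<and> (\<forall>u \<xi> \<zeta>. (u, t) \<in> Q \<longrightarrow> (e, \<xi>) \<in> r \<longrightarrow>
      (\<xi> \<^bold>\<in> ?L) Q u \<longrightarrow> Next_elem r ?L \<xi> \<zeta> Q u \<longrightarrow> (\<zeta>, G \<xi>) \<in> r)" by blast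
  qed
  with G show ?thesis by blast
qed

text \<open>If no projection moved, the next element \<zeta> after a large \<xi> would be closed
  under \<open>f\<close>, giving \<open>f \<xi>\<close> < \<zeta>, whereas \<open>f\<close> defeats
  the set from \<open>e\<close> on.\<close>

lemma defeats_unstable:
  assumes h: "cofinal_name \<kappa> h p" and F: "F \<subseteq> Func (Field r) (Field r)" "|F| <o r"
    and f: "defeats \<kappa> h p F f" and s: "(s, p) \<in> Q"
  shows "\<exists>t y. (t, s) \<in> Q \<and> in_range \<kappa> h t y \<and> proj F y \<noteq> proj (insert f F) y"
proof (rule ccontr)
  let ?L = "proj_name \<kappa> h F"
  assume "\<not> ?thesis"
  then have stable: "\<And>t y. (t, s) \<in> Q \<Longrightarrow> in_range \<kappa> h t y \<Longrightarrow> proj F y = proj (insert f F) y" by blast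
  obtain t e where t: "(t, s) \<in> Q" "e \<in> Field r" and
    low: "\<forall>u \<xi> \<zeta>. (u, t) \<in> Q \<longrightarrow> (e, \<xi>) \<in> r \<longrightarrow> (\<xi> \<^bold>\<in> ?L) Q u \<longrightarrow>
        Next_elem r ?L \<xi> \<zeta> Q u \<longrightarrow> (\<zeta>, f \<xi>) \<in> r"
    using f s unfolding defeats_def by blast
  have cof: "Cofinal_subset r ?L Q p" by (rule cofinal_proj_name[OF h F])
  have tp: "(t, p) \<in> Q" using Q_trans t s by blast
  obtain u \<xi> where u: "(u, t) \<in> Q" "\<xi> \<in> Field r" "(\<xi> \<^bold>\<in> ?L) Q u" "(e, \<xi>) \<in> r"
    using cof tp t(2) unfolding Cofinal_subset_iff by blast
  obtain v \<zeta> where v: "(v, u) \<in> Q" "Next_elem r ?L \<xi> \<zeta> Q v"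
    using next_elem_exists[OF cof Q_trans[OF u(1) tp] u(2)] .
  have vt: "(v, t) \<in> Q" using Q_trans v u by blast
  have le: "(\<zeta>, f \<xi>) \<in> r" using low vt u(4) mem_mono[OF u(3) v(1)] v(2) by blast
  have "(\<zeta> \<^bold>\<in> ?L) Q v" and lt: "lt r \<xi> \<zeta>" using v(2) unfolding Next_elem_iff by blast+
  then obtain w y where w: "(w, v) \<in> Q" "in_range \<kappa> h w y" "\<zeta> = proj F y"
    using mem_proj_nameD Q_Field v(1) by blast
  have "\<zeta> = proj (insert f F) y" using stable[OF _ w(2)] Q_trans[OF Q_trans[OF w(1) vt] t(1)] w(3) by simp
  moreover have "y \<in> Field r" using w(2) unfolding in_range_def by blast
  ultimately have "\<zeta> \<in> closed_under (insert f F)" using proj by blast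
  then have "lt r (f \<xi>) \<zeta>" using lt unfolding closed_under_def by blast
  then show False using le lt_iff r_antisym by blast
qed

text \<open>Stage \<open>i\<close> adds a function that moves the projection of some
  \<open>y\<close> in the range of \<open>h\<close>. As \<open>y\<close> moves only finitely often,
  its stages are enumerated by \<open>e y\<close>; this \<open>e\<close> lies in the ground model,
  and only the range of \<open>h\<close> is generic.\<close>

lemma no_guessing_surjection:
  assumes h: "cofinal_name \<kappa> h p"
    and neg: "\<And>s L. (s, p) \<in> Q \<Longrightarrow> L \<in> names Q (Field r) \<Longrightarrow> Cofinal_subset r L Q s \<Longrightarrow>
      \<exists>t f. (t, s) \<in> Q \<and> f \<in> Func (Field r) (Field r) \<and> (\<forall>u. (u, t) \<in> Q \<longrightarrow> \<not> guesses L f u)"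
  shows "\<exists>e :: 'a \<Rightarrow> nat \<Rightarrow> 'a. \<forall>i\<in>Field r. \<forall>s. (s, p) \<in> Q \<longrightarrow>
    (\<exists>t y n. (t, s) \<in> Q \<and> in_range \<kappa> h t y \<and> e y n = i)"
proof -
  let ?Fn = "Func (Field r) (Field r)"
  have cof_mono: "cofinal_name \<kappa> h s" if "(s, p) \<in> Q" for s
    using h Q_trans[OF _ that] unfolding cofinal_name_def by blast
  have step: "\<exists>g\<in>?Fn. defeats \<kappa> h p F g" if F: "F \<subseteq> ?Fn" "|F| <o r" for F
  proof (rule defeats_exists)
    fix s assume s: "(s, p) \<in> Q"
    show "\<exists>t f. (t, s) \<in> Q \<and> f \<in> ?Fn \<and> (\<forall>u. (u, t) \<in> Q \<longrightarrow> \<not> guesses (proj_name \<kappa> h F) f u)"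
      by (rule neg[OF s _ cofinal_proj_name[OF cof_mono[OF s] F]]) (simp add: proj_name_def name_of_names)
  qed
  have small: "|g ` underS r i| <o r" for g :: "'a \<Rightarrow> 'a \<Rightarrow> 'a" and i
    by (rule image_small[OF underS_small])
  \<comment> \<open>The premise that the earlier functions lie in \<open>?Fn\<close> makes every
    choice of the recursion possible; \<open>gFn\<close> discharges it by induction.\<close>
  have "\<exists>g. \<forall>i. g ` underS r i \<subseteq> ?Fn \<longrightarrow> g i \<in> ?Fn \<and> defeats \<kappa> h p (g ` underS r i) (g i)"
  proof (rule dependent_wf_choice[OF wf_lt])
    fix g g' :: "'a \<Rightarrow> 'a \<Rightarrow> 'a" and i x
    assume "\<And>z. (z, i) \<in> r - Id \<Longrightarrow> g z = g' z"
    then have "g ` underS r i = g' ` underS r i" unfolding underS_def by (intro image_cong) auto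
    then show "(g ` underS r i \<subseteq> ?Fn \<longrightarrow> x \<in> ?Fn \<and> defeats \<kappa> h p (g ` underS r i) x) =
      (g' ` underS r i \<subseteq> ?Fn \<longrightarrow> x \<in> ?Fn \<and> defeats \<kappa> h p (g' ` underS r i) x)" by simp
  next
    fix i and g :: "'a \<Rightarrow> 'a \<Rightarrow> 'a"
    show "\<exists>x. g ` underS r i \<subseteq> ?Fn \<longrightarrow> x \<in> ?Fn \<and> defeats \<kappa> h p (g ` underS r i) x"
      using step[OF _ small] by blast
  qed
  then obtain g where g: "\<forall>i. g ` underS r i \<subseteq> ?Fn \<longrightarrow> g i \<in> ?Fn \<and> defeats \<kappa> h p (g ` underS r i) (g i)"
    by blast
  define F where "F i = g ` underS r i" for i
  have gFn: "g i \<in> ?Fn" for i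
    using wf_lt
  proof (induction i rule: wf_induct_rule)
    case (less i)
    then have "g ` underS r i \<subseteq> ?Fn" unfolding underS_def by blast
    then show ?case using g by blast
  qed
  have FFn: "F i \<subseteq> ?Fn" for i using gFn unfolding F_def by blast
  have Fd: "defeats \<kappa> h p (F i) (g i)" for i using g FFn unfolding F_def by blast
  have Fs: "|F i| <o r" for i unfolding F_def by (rule small)
  define Ch where "Ch y = {i \<in> Field r. proj (F i) y \<noteq> proj (insert (g i) (F i)) y}" for y
  have fin: "finite (Ch y)" if y: "y \<in> Field r" for y
  proof (rule finite_strictly_decreasing)
    show "Ch y \<subseteq> Field r" unfolding Ch_def by blast
    fix i j assume "i \<in> Ch y" "j \<in> Ch y" and ij: "lt r i j"
    have "underS r i \<subseteq> underS r j"
    proof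
      fix k assume "k \<in> underS r i"
      then show "k \<in> underS r j" using lt_le_trans[of k i j] ij lt_iff underS_iff by metis
    qed
    then have "insert (g i) (F i) \<subseteq> F j" using ij underS_iff unfolding F_def by blast
    \<comment> \<open>\<open>F j\<close> already contains \<open>g i\<close>, so the drop at stage
      \<open>i\<close> is inherited by all later stages.\<close>
    then have "(proj (F j) y, proj (insert (g i) (F i)) y) \<in> r" using proj_antimono y by blast
    moreover have "lt r (proj (insert (g i) (F i)) y) (proj (F i) y)"
      using proj_antimono[of "F i" "insert (g i) (F i)" y] y \<open>i \<in> Ch y\<close> unfolding Ch_def lt_iff by auto
    ultimately show "lt r (proj (F j) y) (proj (F i) y)" by (rule le_lt_trans)
  qed
  have "\<exists>e :: nat \<Rightarrow> 'a. Ch y \<subseteq> range e" if y: "y \<in> Field r" for y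
  proof -
    obtain n f where "Ch y = f ` {i::nat. i < n}" using finite_imp_nat_seg_image_inj_on[OF fin[OF y]] by blast
    then show ?thesis by blast
  qed
  then have "\<forall>y\<in>Field r. \<exists>e :: nat \<Rightarrow> 'a. Ch y \<subseteq> range e" by blast
  from bchoice[OF this] obtain e :: "'a \<Rightarrow> nat \<Rightarrow> 'a" where e: "\<forall>y\<in>Field r. Ch y \<subseteq> range (e y)" by blast
  have "\<exists>t y n. (t, s) \<in> Q \<and> in_range \<kappa> h t y \<and> e y n = i" if i: "i \<in> Field r" and s: "(s, p) \<in> Q" for i s
  proof -
    obtain t y where t: "(t, s) \<in> Q" "in_range \<kappa> h t y" "proj (F i) y \<noteq> proj (insert (g i) (F i)) y"
      using defeats_unstable[OF h FFn Fs Fd s] by blast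
    then have "i \<in> Ch y" "y \<in> Field r" using i unfolding Ch_def in_range_def by blast+
    then obtain n where "i = e y n" using e by blast
    then show ?thesis using t by blast
  qed
  then show ?thesis by blast
qed

section \<open>Surjections onto \<lambda> from the domain of the cofinal map\<close>

lemma cofinal_infinite:
  assumes h: "cofinal_name \<kappa> h p" and fn: "is_fun (underS r \<kappa>) (Field r) h Q p" and p: "p \<in> Field Q"
  shows "infinite (underS r \<kappa>)"
proof
  assume fin: "finite (underS r \<kappa>)"
  \<comment> \<open>One condition decides all the finitely many values, so they have a ground model
    bound \<open>b\<close>, contradicting cofinality.\<close>
  obtain s v where s: "(s, p) \<in> Q" and v: "\<forall>a\<in>underS r \<kappa>. v a \<in> Field r \<and> ((a, v a) \<^bold>\<in> h) Q s"
    using finite_fun_decided[OF fn fin subset_refl p] by blast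
  have "v ` underS r \<kappa> \<subseteq> Field r" using v by blast
  moreover have "|v ` underS r \<kappa>| <o r" using fin by (intro finite_small) simp
  ultimately obtain b where b: "b \<in> Field r" "\<forall>k\<in>v ` underS r \<kappa>. lt r k b" using bounded by metis
  obtain u \<xi> \<eta> where u: "(u, s) \<in> Q" "\<xi> \<in> underS r \<kappa>" "\<eta> \<in> Field r" "((\<xi>, \<eta>) \<^bold>\<in> h) Q u" "(b, \<eta>) \<in> r"
    using h s b(1) unfolding cofinal_name_def by blast
  have "((\<xi>, v \<xi>) \<^bold>\<in> h) Q u" using mem_mono[of "(\<xi>, v \<xi>)" h s u] u(1,2) v by blast
  then have "v \<xi> = \<eta>" using is_fun_unique[OF fn u(2) Q_trans[OF u(1) s]] u(3,4) v u(2) by blast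
  then have "lt r \<eta> b" using b(2) u(2) by blast
  then show False using u(5) lt_iff r_antisym by blast
qed

text \<open>\<open>S s l i\<close> is to be read as: \<open>s\<close> decides the value at \<open>l\<close> of a partial function to be \<open>i\<close>.\<close>

definition surjection :: "'a \<Rightarrow> 'p \<Rightarrow> ('p \<Rightarrow> 'a \<Rightarrow> 'a \<Rightarrow> bool) \<Rightarrow> bool" where
  "surjection \<kappa> p S \<longleftrightarrow> (\<forall>s t l i. S s l i \<longrightarrow> (t, s) \<in> Q \<longrightarrow> S t l i) \<and>
     (\<forall>s l i i'. (s, p) \<in> Q \<longrightarrow> S s l i \<longrightarrow> S s l i' \<longrightarrow> i = i') \<and>
     (\<forall>i\<in>Field r. \<forall>s. (s, p) \<in> Q \<longrightarrow> (\<exists>t. (t, s) \<in> Q \<and> (\<exists>l\<in>underS r \<kappa>. S t l i)))"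

lemma surjectionD:
  assumes "surjection \<kappa> p S"
  shows surjection_mono: "S s l i \<Longrightarrow> (t, s) \<in> Q \<Longrightarrow> S t l i"
    and surjection_unique: "(s, p) \<in> Q \<Longrightarrow> S s l i \<Longrightarrow> S s l i' \<Longrightarrow> i = i'"
    and surjection_onto: "i \<in> Field r \<Longrightarrow> (s, p) \<in> Q \<Longrightarrow> \<exists>t l. (t, s) \<in> Q \<and> l \<in> underS r \<kappa> \<and> S t l i"
  using assms unfolding surjection_def by blast+

text \<open>An ordinal \<open>l\<close> codes a pair of some \<xi> and \<open>n\<close>, and is sent
  to the \<open>n\<close>-th stage listed for the value of \<open>h\<close> at \<xi>.\<close>

lemma guessing_or_surjection:
  assumes h: "cofinal_name \<kappa> h p" and fn: "is_fun (underS r \<kappa>) (Field r) h Q p" and p: "p \<in> Field Q"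
    and neg: "\<And>s L. (s, p) \<in> Q \<Longrightarrow> L \<in> names Q (Field r) \<Longrightarrow> Cofinal_subset r L Q s \<Longrightarrow>
      \<exists>t f. (t, s) \<in> Q \<and> f \<in> Func (Field r) (Field r) \<and> (\<forall>u. (u, t) \<in> Q \<longrightarrow> \<not> guesses L f u)"
  shows "\<exists>S. surjection \<kappa> p S"
proof -
  obtain e :: "'a \<Rightarrow> nat \<Rightarrow> 'a" where e: "\<forall>i\<in>Field r. \<forall>s. (s, p) \<in> Q \<longrightarrow>
    (\<exists>t y n. (t, s) \<in> Q \<and> in_range \<kappa> h t y \<and> e y n = i)"
    using no_guessing_surjection[OF h neg] by blast
  obtain \<pi> :: "'a \<Rightarrow> 'a \<times> nat" where \<pi>: "\<pi> ` underS r \<kappa> = underS r \<kappa> \<times> UNIV"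
    using infinite_pairing[OF cofinal_infinite[OF h fn p]] by blast
  \<comment> \<open>Outside \<kappa> nothing is known about \<open>\<pi>\<close>; the guard keeps
    the argument of \<open>h\<close> in its domain, where values are unique.\<close>
  define S where "S s l i \<longleftrightarrow> fst (\<pi> l) \<in> underS r \<kappa> \<and>
    (\<exists>y\<in>Field r. ((fst (\<pi> l), y) \<^bold>\<in> h) Q s \<and> e y (snd (\<pi> l)) = i)" for s l i
  have "surjection \<kappa> p S"
    unfolding surjection_def
  proof (intro conjI allI impI ballI)
    fix s t l i assume "S s l i" "(t, s) \<in> Q"
    then show "S t l i" unfolding S_def using mem_mono[of _ h s t] by blast
  next
    fix s l i i' assume s: "(s, p) \<in> Q" and "S s l i" "S s l i'"
    then obtain y y' where y: "fst (\<pi> l) \<in> underS r \<kappa>" "y \<in> Field r" "y' \<in> Field r"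
      "((fst (\<pi> l), y) \<^bold>\<in> h) Q s" "((fst (\<pi> l), y') \<^bold>\<in> h) Q s"
      "e y (snd (\<pi> l)) = i" "e y' (snd (\<pi> l)) = i'" unfolding S_def by blast
    then show "i = i'" using is_fun_unique[OF fn y(1) s y(4,5,2,3)] by simp
  next
    fix i s assume "i \<in> Field r" "(s, p) \<in> Q"
    with e obtain t y n where t: "(t, s) \<in> Q" "in_range \<kappa> h t y" "e y n = i" by blast
    then obtain \<xi> where \<xi>: "\<xi> \<in> underS r \<kappa>" "y \<in> Field r" "((\<xi>, y) \<^bold>\<in> h) Q t"
      unfolding in_range_def by blast
    then have "(\<xi>, n) \<in> \<pi> ` underS r \<kappa>" unfolding \<pi> by blast
    then obtain l where l: "l \<in> underS r \<kappa>" "\<pi> l = (\<xi>, n)" by force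
    have "S t l i" unfolding S_def l(2) using \<xi> t by auto
    then show "\<exists>t. (t, s) \<in> Q \<and> (\<exists>l\<in>underS r \<kappa>. S t l i)" using t l by blast
  qed
  then show ?thesis by blast
qed

text \<open>Cantor's diagonal argument in the extension.\<close>

lemma no_surjection_Bij_power:
  assumes S: "surjection \<kappa> p S" and B: "Bij_power r \<mu> \<kappa> Q p" and p: "p \<in> Field Q"
  shows False
proof -
  obtain s e where s: "(s, p) \<in> Q" and
    onto: "fAll_sub (underS r \<kappa>) (\<lambda>X. fEx (underS r \<mu>) (\<lambda>\<xi>.
       fAll (underS r \<kappa>) (\<lambda>\<eta>. (\<eta> \<^bold>\<in> X) \<^bold>\<longleftrightarrow> ((\<xi>, \<eta>) \<^bold>\<in> e)))) Q s"
    using B Q_refl[OF p] unfolding Bij_power_def fEx_sub_iff fAnd_def by blast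
  \<comment> \<open>The diagonal set: the surjection sends \<open>l\<close> to some
    \<open>i\<close>, and \<open>l\<close> is not in the \<open>i\<close>-th set coded by
    \<open>e\<close>.\<close>
  let ?P = "\<lambda>s l. \<exists>i. S s l i \<and> (\<forall>t. (t, s) \<in> Q \<longrightarrow> \<not> ((i, l) \<^bold>\<in> e) Q t)"
  let ?X = "name_of (underS r \<kappa>) ?P"
  have mono: "?P t l" if "?P s l" "(t, s) \<in> Q" for s t l
    using that surjection_mono[OF S _ that(2)] Q_trans[OF _ that(2)] by blast
  have "fEx (underS r \<mu>) (\<lambda>\<xi>. fAll (underS r \<kappa>) (\<lambda>\<eta>. (\<eta> \<^bold>\<in> ?X) \<^bold>\<longleftrightarrow> ((\<xi>, \<eta>) \<^bold>\<in> e))) Q s"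
    using onto name_of_names unfolding fAll_sub_def by blast
  then obtain t \<xi> where t: "(t, s) \<in> Q" "\<xi> \<in> underS r \<mu>" and
    X: "\<forall>\<eta>\<in>underS r \<kappa>. ((\<eta> \<^bold>\<in> ?X) \<^bold>\<longrightarrow> ((\<xi>, \<eta>) \<^bold>\<in> e)) Q t \<and> (((\<xi>, \<eta>) \<^bold>\<in> e) \<^bold>\<longrightarrow> (\<eta> \<^bold>\<in> ?X)) Q t"
    using Q_refl Q_Field s unfolding fEx_iff fAll_def fIff_def fAnd_def by blast
  have \<xi>: "\<xi> \<in> Field r" using t(2) lt_Field underS_iff by blast
  \<comment> \<open>The index \<xi> of the diagonal set is itself the value of the surjection at
    some \<open>l\<close>, so \<open>l\<close> lies in the set with index \<xi> exactly when it does
    not.\<close>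
  obtain u l where u: "(u, t) \<in> Q" "l \<in> underS r \<kappa>" "S u l \<xi>"
    using surjection_onto[OF S \<xi> Q_trans[OF t(1) s]] by blast
  have up: "(u, p) \<in> Q" by (rule Q_trans[OF Q_trans[OF u(1) t(1)] s])
  have uF: "u \<in> Field Q" using Q_Field u by blast
  show False
  proof (cases "\<exists>v. (v, u) \<in> Q \<and> ((\<xi>, l) \<^bold>\<in> e) Q v")
    case True
    then obtain v where v: "(v, u) \<in> Q" "((\<xi>, l) \<^bold>\<in> e) Q v" by blast
    have "(((\<xi>, l) \<^bold>\<in> e) \<^bold>\<longrightarrow> (l \<^bold>\<in> ?X)) Q t" using X u(2) by blast
    then obtain w where w: "(w, v) \<in> Q" "(l \<^bold>\<in> ?X) Q w"
      using v Q_trans[OF v(1) u(1)] unfolding imp_iff by blast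
    have wF: "w \<in> Field Q" using w Q_Field by blast
    obtain x where x: "(x, w) \<in> Q" "?P x l" by (rule mem_name_ofD[OF w(2) wF mono])
    then obtain i where i: "S x l i" "\<And>t. (t, x) \<in> Q \<Longrightarrow> \<not> ((i, l) \<^bold>\<in> e) Q t" by blast
    have xv: "(x, v) \<in> Q" by (rule Q_trans[OF x(1) w(1)])
    have xu: "(x, u) \<in> Q" by (rule Q_trans[OF xv v(1)])
    have "i = \<xi>"
      by (rule surjection_unique[OF S Q_trans[OF xu up] i(1) surjection_mono[OF S u(3) xu]])
    moreover have "((\<xi>, l) \<^bold>\<in> e) Q x" by (rule mem_mono[OF v(2) xv])
    ultimately show False using i(2) Q_refl Q_Field x(1) by blast
  next
    case False
    then have "(l \<^bold>\<in> ?X) Q u" using u by (intro mem_name_ofI uF) blast+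
    moreover have "((l \<^bold>\<in> ?X) \<^bold>\<longrightarrow> ((\<xi>, l) \<^bold>\<in> e)) Q t" using X u(2) by blast
    ultimately show False using u(1) False unfolding imp_iff by blast
  qed
qed

text \<open>
  The Cantor-Bernstein construction in the extension.  \<open>R s x y\<close> says that \<open>x\<close> is the first
  preimage of \<open>y\<close>; the bijection from \<open>\<kappa>\<close> to \<open>\<lambda>\<close> follows \<open>R\<close> on those \<open>x\<close> whose forward
  \<open>R\<close>-orbit leaves \<open>\<kappa>\<close>, and is the identity elsewhere.
\<close>

lemma no_surjection_Cardinal:
  assumes S: "surjection \<kappa> p S" and card_p: "Cardinal r Q p" and p: "p \<in> Field Q" and \<kappa>: "\<kappa> \<in> Field r"
  shows False
proof -
  let ?K = "underS r \<kappa>"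
  have KF: "?K \<subseteq> Field r" using lt_Field underS_iff by blast
  define R where "R s x y \<longleftrightarrow> (s, p) \<in> Q \<and> x \<in> ?K \<and> y \<in> Field r \<and> S s x y \<and>
    (\<forall>x' t. x' \<in> ?K \<longrightarrow> lt r x' x \<longrightarrow> (t, s) \<in> Q \<longrightarrow> \<not> S t x' y)" for s x y
  have R_mono: "R t x y" if "R s x y" "(t, s) \<in> Q" for s t x y
    using that(1) surjection_mono[OF S _ that(2)] Q_trans[OF _ that(2)] Q_trans[OF that(2)]
    unfolding R_def by blast
  have R_unique: "y = y'" if "R s x y" "R s x y'" for s x y y'
    using that surjection_unique[OF S] unfolding R_def by blast
  have R_first: "\<not> lt r x' x" if "R s x y" "R s x' y" for s x x' y
    using that Q_refl Q_Field unfolding R_def by blast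
  have R_inj: "x = x'" if "R s x y" "R s x' y" for s x x' y
  proof -
    have "x \<in> Field r" "x' \<in> Field r" using that KF unfolding R_def by blast+
    then have "(x, x') \<in> r" "(x', x) \<in> r" using R_first[OF that] R_first[OF that(2,1)] not_le by blast+
    then show ?thesis by (rule r_antisym)
  qed
  have R_total: "\<exists>t x. (t, s) \<in> Q \<and> R t x y" if y: "y \<in> Field r" and s: "(s, p) \<in> Q" for s y
  proof -
    \<comment> \<open>The least \<open>x\<close> that some extension sends to \<open>y\<close>:
      minimality rules out smaller preimages at all further extensions.\<close>
    let ?P = "\<lambda>x. x \<in> ?K \<and> (\<exists>t. (t, s) \<in> Q \<and> S t x y)"
    obtain l where l: "?P l" using surjection_onto[OF S y s] by blast
    have "l \<in> Field r" using l KF by blast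
    then obtain x where x: "?P x" and min: "\<And>x'. lt r x' x \<Longrightarrow> \<not> ?P x'"
      by (rule least[of l ?P, OF _ l]) (rule that)
    then obtain t where t: "(t, s) \<in> Q" "S t x y" by blast
    have "R t x y" unfolding R_def using t x y min Q_trans[OF _ t(1)] Q_trans[OF t(1) s] by blast
    with t show ?thesis by blast
  qed
  define C where "C s = reach (R s) ?K" for s
  have C_mono: "C t x" if "C s x" "(t, s) \<in> Q" for s t x
    using that(1) unfolding C_def by (rule reach_mono) (rule R_mono[OF _ that(2)])
  have C_R: "\<exists>y. R s x y \<and> (y \<notin> ?K \<or> C s y)" if "C s x" for s x
    using that unfolding C_def by cases blast+
  \<comment> \<open>The universal quantifier over \<open>t\<close> expresses that \<open>s\<close>
    forces the orbit to stay in \<kappa>; a mere failure of \<open>C\<close> at \<open>s\<close>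
    would not persist to extensions.\<close>
  define P where "P s xy \<longleftrightarrow> (s, p) \<in> Q \<and> (C s (fst xy) \<and> R s (fst xy) (snd xy) \<or>
    fst xy = snd xy \<and> fst xy \<in> ?K \<and> (\<forall>t. (t, s) \<in> Q \<longrightarrow> \<not> C t (fst xy)))" for s xy
  have P_mono: "P t xy" if "P s xy" "(t, s) \<in> Q" for s t xy
    using that(1) C_mono[OF _ that(2)] R_mono[OF _ that(2)] Q_trans[OF _ that(2)] Q_trans[OF that(2)]
    unfolding P_def by blast
  have P_id: "P s (x, x)" if "x \<in> ?K" "(s, p) \<in> Q" "\<not> (\<exists>t. (t, s) \<in> Q \<and> C t x)" for s x
    using that unfolding P_def by simp
  have P_R: "P s (x, y)" if "C s x" "R s x y" for s x y
    using that unfolding P_def R_def by simp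
  let ?h = "name_of (?K \<times> Field r) P"
  have total: "\<exists>t y. (t, s) \<in> Q \<and> y \<in> Field r \<and> P t (x, y)" if s: "(s, p) \<in> Q" and x: "x \<in> ?K" for s x
  proof (cases "\<exists>t. (t, s) \<in> Q \<and> C t x")
    case True
    then obtain t y where t: "(t, s) \<in> Q" "C t x" "R t x y" using C_R by blast
    moreover have "y \<in> Field r" using t(3) unfolding R_def by blast
    ultimately show ?thesis using P_R by blast
  next
    case False
    then show ?thesis using P_id[OF x s] Q_refl Q_Field s x KF by blast
  qed
  have cases: "C s x \<and> R s x y \<or> x = y \<and> x \<in> ?K \<and> \<not> C s x" if "P s (x, y)" for s x y
    using that Q_refl Q_Field unfolding P_def by auto
  have unique: "y = y'" if "P s (x, y)" "P s (x, y')" for s x y y'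
    using cases[OF that(1)] cases[OF that(2)] R_unique by blast
  have inj: "x = x'" if "P s (x, y)" "P s (x', y)" for s x x' y
  proof -
    \<comment> \<open>This excludes a collision between the two clauses: following \<open>R\<close>
      from a point of \<open>C\<close> leads out of \<kappa> or back into \<open>C\<close>, whereas
      fixed points lie in \<kappa> outside \<open>C\<close>.\<close>
    have "y \<notin> ?K \<or> C s y" if "C s z" "R s z y" for z
      using C_R[OF that(1)] R_unique[OF that(2)] by blast
    then show ?thesis using cases[OF that(1)] cases[OF that(2)] R_inj by blast
  qed
  have onto: "\<exists>t x. (t, s) \<in> Q \<and> x \<in> ?K \<and> P t (x, y)" if y: "y \<in> Field r" and s: "(s, p) \<in> Q" for s y
  proof (cases "y \<in> ?K \<and> \<not> (\<exists>t. (t, s) \<in> Q \<and> C t y)")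
    case True
    then show ?thesis using P_id[of y s] s Q_refl Q_Field by blast
  next
    case False
    \<comment> \<open>A first preimage of such a \<open>y\<close> has an orbit leaving \<kappa>,
      either at once or by continuing through \<open>y\<close>.\<close>
    then obtain t where t: "(t, s) \<in> Q" "y \<notin> ?K \<or> C t y" using Q_refl Q_Field s by blast
    obtain u x where u: "(u, t) \<in> Q" "R u x y" using R_total[OF y Q_trans[OF t(1) s]] by blast
    have "y \<notin> ?K \<or> C u y" using C_mono t(2) u(1) by blast
    then have "C u x" using u(2) reach.intros unfolding C_def by metis
    then have "P u (x, y)" using P_R u(2) by blast
    moreover have "x \<in> ?K" using u(2) unfolding R_def by blast
    ultimately show ?thesis using Q_trans[OF u(1) t(1)] by blast
  qed
  have D: "\<exists>t. (t, s) \<in> Q \<and> P t xy" if "(xy \<^bold>\<in> ?h) Q s" "s \<in> Field Q" for s xy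
    by (rule mem_name_ofD[OF that P_mono]) auto
  have fn: "is_fun ?K (Field r) ?h Q s" if s: "(s, p) \<in> Q" for s
    by (rule is_fun_mono[OF is_fun_name_of s])
      (use P_mono total unique in blast)+
  have h_inj: "x = x'" if m: "((x, y) \<^bold>\<in> ?h) Q s" "((x', y) \<^bold>\<in> ?h) Q s" and s: "s \<in> Field Q" for s x x' y
  proof -
    obtain t where t: "(t, s) \<in> Q" "P t (x, y)" using D[OF m(1) s] by blast
    then obtain u where "(u, t) \<in> Q" "P u (x', y)" using D[OF mem_mono[OF m(2) t(1)]] Q_Field by blast
    then show ?thesis using inj[OF P_mono[OF t(2)]] by blast
  qed
  have h_onto: "\<exists>t. (t, s) \<in> Q \<and> (\<exists>x\<in>?K. ((x, y) \<^bold>\<in> ?h) Q t)" if y: "y \<in> Field r" and s: "(s, p) \<in> Q" for s y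
  proof -
    obtain t x where t: "(t, s) \<in> Q" "x \<in> ?K" "P t (x, y)" using onto[OF y s] by blast
    have "((x, y) \<^bold>\<in> ?h) Q t" by (rule mem_name_ofI) (use t y Q_Field in blast)+
    with t show ?thesis by blast
  qed
  have andI: "\<phi> Q s \<Longrightarrow> \<psi> Q s \<Longrightarrow> (\<phi> \<^bold>\<and> \<psi>) Q s" for \<phi> \<psi> s
    by (simp add: fAnd_def)
  have "(is_fun ?K (Field r) ?h \<^bold>\<and>
     fAll ?K (\<lambda>\<xi>. fAll ?K (\<lambda>\<xi>'. fAll (Field r) (\<lambda>\<eta>.
       (((\<xi>, \<eta>) \<^bold>\<in> ?h) \<^bold>\<and> ((\<xi>', \<eta>) \<^bold>\<in> ?h)) \<^bold>\<longrightarrow> Ground (\<xi> = \<xi>')))) \<^bold>\<and>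
     fAll (Field r) (\<lambda>\<eta>. fEx ?K (\<lambda>\<xi>. (\<xi>, \<eta>) \<^bold>\<in> ?h))) Q s" if "(s, p) \<in> Q" for s
  proof (intro andI)
    show "is_fun ?K (Field r) ?h Q s" by (rule fn[OF that])
    show "fAll ?K (\<lambda>\<xi>. fAll ?K (\<lambda>\<xi>'. fAll (Field r) (\<lambda>\<eta>.
       (((\<xi>, \<eta>) \<^bold>\<in> ?h) \<^bold>\<and> ((\<xi>', \<eta>) \<^bold>\<in> ?h)) \<^bold>\<longrightarrow> Ground (\<xi> = \<xi>')))) Q s"
      unfolding fAll_def imp_Ground_iff using h_inj Q_Field unfolding fAnd_def by blast
    show "fAll (Field r) (\<lambda>\<eta>. fEx ?K (\<lambda>\<xi>. (\<xi>, \<eta>) \<^bold>\<in> ?h)) Q s"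
      unfolding fAll_def fEx_iff using h_onto Q_trans[OF _ that] by blast
  qed
  then have "fEx_fun ?K (Field r) (\<lambda>h. fAll ?K (\<lambda>\<xi>. fAll ?K (\<lambda>\<xi>'. fAll (Field r) (\<lambda>\<eta>.
       (((\<xi>, \<eta>) \<^bold>\<in> h) \<^bold>\<and> ((\<xi>', \<eta>) \<^bold>\<in> h)) \<^bold>\<longrightarrow> Ground (\<xi> = \<xi>')))) \<^bold>\<and>
     fAll (Field r) (\<lambda>\<eta>. fEx ?K (\<lambda>\<xi>. (\<xi>, \<eta>) \<^bold>\<in> h))) Q p"
    unfolding fEx_fun_def fEx_sub_iff using name_of_names Q_refl Q_Field by blast
  then show False
    by (rule fNotD[OF fAllD[OF card_p[unfolded Cardinal_def] \<kappa>] p])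
qed

section \<open>Guessing sets in the singular cases\<close>

lemma singular_guessing:
  assumes cof: "Cofinal_map r \<kappa> Q p"
    and no_surj: "\<And>s S. (s, p) \<in> Q \<Longrightarrow> \<not> surjection \<kappa> s S"
  shows "Guessing_set r Q p"
proof (rule Guessing_setI, rule ccontr)
  fix q assume q: "(q, p) \<in> Q" and
    neg: "\<not> (\<exists>s L. (s, q) \<in> Q \<and> L \<in> names Q (Field r) \<and> Cofinal_subset r L Q s \<and>
      (\<forall>f\<in>Func (Field r) (Field r). \<forall>t. (t, s) \<in> Q \<longrightarrow> (\<exists>u. (u, t) \<in> Q \<and> guesses L f u)))"
  obtain s h where s: "(s, q) \<in> Q" "is_fun (underS r \<kappa>) (Field r) h Q s" "cofinal_name \<kappa> h s"
    using cof q unfolding Cofinal_map_iff cofinal_name_def by blast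
  \<comment> \<open>Failure at \<open>q\<close> supplies, for every cofinal name below
    \<open>q\<close>, a ground model function that some extension keeps unguessed.\<close>
  have "\<exists>S. surjection \<kappa> s S"
  proof (rule guessing_or_surjection[OF s(3,2)])
    show "s \<in> Field Q" using s Q_Field by blast
    fix s' L assume L: "(s', s) \<in> Q" "L \<in> names Q (Field r)" "Cofinal_subset r L Q s'"
    have "(s', q) \<in> Q" by (rule Q_trans[OF L(1) s(1)])
    then show "\<exists>t f. (t, s') \<in> Q \<and> f \<in> Func (Field r) (Field r) \<and> (\<forall>u. (u, t) \<in> Q \<longrightarrow> \<not> guesses L f u)"
      using neg L by blast
  qed
  then show False using no_surj Q_trans[OF s(1) q] by blast
qed

text \<open>An existential statement of the forcing language is forced once it is forced densely.
  This permits passing to conditions that decide \<kappa> and the value of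
  \<open>2^\<kappa>\<close>.\<close>

lemma Guessing_set_dense:
  assumes "\<And>q. (q, p) \<in> Q \<Longrightarrow> \<exists>s. (s, q) \<in> Q \<and> Guessing_set r Q s"
  shows "Guessing_set r Q p"
  unfolding Guessing_set_def fEx_sub_iff
proof (intro allI impI)
  fix q assume "(q, p) \<in> Q"
  then obtain s where s: "(s, q) \<in> Q" "Guessing_set r Q s" using assms by blast
  then have "(s, s) \<in> Q" using Q_refl Q_Field by blast
  with s(2)[unfolded Guessing_set_def fEx_sub_iff] show "\<exists>s. (s, q) \<in> Q \<and> (\<exists>\<tau>\<in>names Q (Field r).
    (Cofinal_subset r \<tau> \<^bold>\<and> fAll (Func (Field r) (Field r)) (\<lambda>f. fEx (Field r) (\<lambda>\<xi>. (\<xi> \<^bold>\<in> \<tau>) \<^bold>\<and>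
       fEx (Field r) (\<lambda>\<zeta>. Next_elem r \<tau> \<xi> \<zeta> \<^bold>\<and> Ground (lt r (f \<xi>) \<zeta>))))) Q s)"
    using Q_trans[OF _ s(1)] by blast
qed

lemma Cofinal_map_mono: "Cofinal_map r \<kappa> Q p \<Longrightarrow> (q, p) \<in> Q \<Longrightarrow> Cofinal_map r \<kappa> Q q"
  unfolding Cofinal_map_def fEx_fun_def fEx_sub_iff using Q_trans[of _ q p] by blast

lemma Bij_power_mono: "Bij_power r \<mu> \<kappa> Q p \<Longrightarrow> (q, p) \<in> Q \<Longrightarrow> Bij_power r \<mu> \<kappa> Q q"
  unfolding Bij_power_def fEx_sub_iff using Q_trans[of _ q p] by blast

lemma Cardinal_singular_guessing:
  assumes C: "forced Q (Cardinal r)" and S: "forced Q (Singular r)" and p: "p \<in> Field Q"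
  shows "Guessing_set r Q p"
proof (rule Guessing_set_dense)
  fix q assume "(q, p) \<in> Q"
  moreover have "Singular r Q p" using S p unfolding forced_def by blast
  ultimately obtain s \<kappa> where s: "(s, q) \<in> Q" "\<kappa> \<in> Field r" "Cofinal_map r \<kappa> Q s"
    unfolding Singular_def fEx_iff Cf_eq_def fAnd_def by blast
  have "Guessing_set r Q s"
  proof (rule singular_guessing[OF s(3)], rule notI)
    fix t T assume "(t, s) \<in> Q" "surjection \<kappa> t T"
    then show False using no_surjection_Cardinal C s(2) Q_Field unfolding forced_def by blast
  qed
  with s(1) show "\<exists>s. (s, q) \<in> Q \<and> Guessing_set r Q s" by blast
qed

lemma Two_power_cf_less_guessing:
  assumes "Two_power_cf_less r Q p"
  shows "Guessing_set r Q p"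
proof (rule Guessing_set_dense)
  fix q assume "(q, p) \<in> Q"
  with assms obtain s \<kappa> where s: "(s, q) \<in> Q" "\<kappa> \<in> Field r" "Cf_eq r \<kappa> Q s"
    "fEx (Field r) (\<lambda>\<mu>. Two_power_eq r \<kappa> \<mu>) Q s"
    unfolding Two_power_cf_less_def fEx_iff[of "Field r" _ Q p] fAnd_def by blast
  have "(s, s) \<in> Q" using s(1) Q_refl Q_Field by blast
  with s(4) obtain t \<mu> where t: "(t, s) \<in> Q" "Bij_power r \<mu> \<kappa> Q t"
    unfolding fEx_iff Two_power_eq_def fAnd_def by blast
  have "Cofinal_map r \<kappa> Q t"
    using s(3) Cofinal_map_mono[OF _ t(1)] unfolding Cf_eq_def fAnd_def by blast
  then have "Guessing_set r Q t"
  proof (rule singular_guessing, intro notI)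
    fix u T assume u: "(u, t) \<in> Q" "surjection \<kappa> u T"
    show False using no_surjection_Bij_power[OF u(2) Bij_power_mono[OF t(2) u(1)]] Q_Field u(1) by blast
  qed
  with Q_trans[OF t(1) s(1)] show "\<exists>s. (s, q) \<in> Q \<and> Guessing_set r Q s" by blast
qed

end

theorem propositionB:
  fixes r :: "'a rel" and Q :: "'p rel"
  assumes "Card_order r" and "regularCard r" and "natLeq <o r"
    and "ctwo ^c r =o cardSuc r"
    and "notion_of_forcing Q" and "chain_condition (cardSuc r) Q" and "|Field Q| \<le>o ctwo ^c r"
  shows "(forced Q (Regular r) \<and> forced Q (Unbounded_function r) \<longrightarrow> in_class_C r Q) \<and>
         (forced Q (Cardinal r \<^bold>\<and> Singular r) \<longrightarrow> in_class_C r Q) \<and>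
         (forced Q (Singular r \<^bold>\<and> Two_power_cf_less r) \<longrightarrow> in_class_C r Q)"
proof -
  interpret cc_forcing_ground Q r by unfold_locales (use assms in auto)
  have *: "in_class_C r Q" if "\<And>p. p \<in> Field Q \<Longrightarrow> Guessing_set r Q p"
    using that assms unfolding in_class_C_def forced_def by blast
  show ?thesis
  proof (intro conjI impI)
    assume "forced Q (Regular r) \<and> forced Q (Unbounded_function r)"
    then show "in_class_C r Q" using unbounded_guessing * unfolding forced_def by blast
  next
    assume "forced Q (Cardinal r \<^bold>\<and> Singular r)"
    then have "forced Q (Cardinal r)" "forced Q (Singular r)" unfolding forced_def fAnd_def by blast+
    then show "in_class_C r Q" using Cardinal_singular_guessing * by blast
  next
    assume "forced Q (Singular r \<^bold>\<and> Two_power_cf_less r)"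
    then show "in_class_C r Q" using Two_power_cf_less_guessing * unfolding forced_def fAnd_def by blast
  qed
qed

end
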